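(* Let $\Omega\subseteq\mathbb{C}$ be a domain, let $\mathcal{F}$ be a family of meromorphic functions on $\Omega$, and let $\psi_1,\psi_2,\psi_3$ be pairwise distinct (i.e. pairwise not identically equal) meromorphic functions on $\Omega$. Suppose that (i) every pair $f,g\in\mathcal{F}$ shares the set $S=\{\psi_1(z),\psi_2(z),\psi_3(z)\}$ in $\Omega$; (ii) for every $f\in\mathcal{F}$ and every $z_0\in\Omega$: if $\psi_i(z_0)=\psi_j(z_0)$ for some $i\neq j$ in $\{1,2,3\}$, then $f(z_0)\neq\psi_i(z_0)$. Then $\mathcal{F}$ is normal in $\Omega$.
   Context: Values are taken in the extended complex plane $\overline{\mathbb{C}}=\mathbb{C}\cup\{\infty\}$, so $f(z_0)=\psi_i(z_0)$ includes the case where both equal $\infty$. Two meromorphic functions $f,g$ on $\Omega$ share the set $S=\{\psi_1(z),\psi_2(z),\psi_3(z)\}$ (ignoring multiplicities) in $\Omega$ if $\{z\in\Omega: f(z)\in\{\psi_1(z),\psi_2(z),\psi_3(z)\}\}=\{z\in\Omega: g(z)\in\{\psi_1(z),\psi_2(z),\psi_3(z)\}\}$. A family of meromorphic functions on $\Omega$ is normal in $\Omega$ if every sequence in it has a subsequence converging locally uniformly on $\Omega$ with respect to the spherical metric to a meromorphic function or to the constant $\infty$. *)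

theory Defs
  imports "HOL-Analysis.Analysis"
begin

text \<open>Extended complex plane: \<open>Some a\<close> is the finite value a, \<open>None\<close> is \<infinity>.\<close>

fun chordal :: "complex option \<Rightarrow> complex option \<Rightarrow> real" where
  "chordal (Some a) (Some b) =
     2 * cmod (a - b) / (sqrt (1 + (cmod a)\<^sup>2) * sqrt (1 + (cmod b)\<^sup>2))"
| "chordal (Some a) None = 2 / sqrt (1 + (cmod a)\<^sup>2)"
| "chordal None (Some b) = 2 / sqrt (1 + (cmod b)\<^sup>2)"
| "chordal None None = 0"

definition mero_on :: "(complex \<Rightarrow> complex option) \<Rightarrow> complex set \<Rightarrow> bool" where
  "mero_on f \<Omega> \<longleftrightarrow>
     (\<forall>z\<in>\<Omega>. \<not> z islimpt {w\<in>\<Omega>. f w = None}) \<and>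
     (\<lambda>z. the (f z)) holomorphic_on {w\<in>\<Omega>. f w \<noteq> None} \<and>
     (\<forall>p\<in>\<Omega>. f p = None \<longrightarrow> filterlim (\<lambda>z. the (f z)) at_infinity (at p))"

definition shares_set ::
  "(complex \<Rightarrow> complex option) \<Rightarrow> (complex \<Rightarrow> complex option) \<Rightarrow>
   (complex \<Rightarrow> complex option) \<Rightarrow> (complex \<Rightarrow> complex option) \<Rightarrow>
   (complex \<Rightarrow> complex option) \<Rightarrow> complex set \<Rightarrow> bool" where
  "shares_set f g \<psi>1 \<psi>2 \<psi>3 \<Omega> \<longleftrightarrow>
     {z\<in>\<Omega>. f z \<in> {\<psi>1 z, \<psi>2 z, \<psi>3 z}} = {z\<in>\<Omega>. g z \<in> {\<psi>1 z, \<psi>2 z, \<psi>3 z}}"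

definition locally_uniform_chordal ::
  "(nat \<Rightarrow> complex \<Rightarrow> complex option) \<Rightarrow> (complex \<Rightarrow> complex option) \<Rightarrow> complex set \<Rightarrow> bool" where
  "locally_uniform_chordal s g \<Omega> \<longleftrightarrow>
     (\<forall>K. compact K \<and> K \<subseteq> \<Omega> \<longrightarrow>
        (\<forall>e>0. \<forall>\<^sub>F n in sequentially. \<forall>z\<in>K. chordal (s n z) (g z) < e))"

definition normal_family_mero :: "(complex \<Rightarrow> complex option) set \<Rightarrow> complex set \<Rightarrow> bool" where
  "normal_family_mero F \<Omega> \<longleftrightarrow>
     (\<forall>s :: nat \<Rightarrow> complex \<Rightarrow> complex option. (\<forall>n. s n \<in> F) \<longrightarrow>
        (\<exists>r g. strict_mono r \<and> (mero_on g \<Omega> \<or> g = (\<lambda>z. None)) \<and>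
               locally_uniform_chordal (s \<circ> r) g \<Omega>))"

end

theory Submission
  imports Defs "HOL-Complex_Analysis.Great_Picard" "HOL-Library.Diagonal_Subsequence"
begin

text \<open>By (i), unless every member of the family coincides with some \<open>\<psi>\<^sub>i\<close>, each point \<open>z\<close> has a
  punctured disc on which all members omit the pairwise distinct values \<open>\<psi>\<^sub>1\<close>, \<open>\<psi>\<^sub>2\<close>, \<open>\<psi>\<^sub>3\<close>; by (ii),
  each member omits two of these functions, \<open>a\<close> and \<open>b\<close> say, at \<open>z\<close> as well. After a rotation of the
  sphere \<open>a\<close> and \<open>b\<close> are finite at \<open>z\<close>, so \<open>1 / (f - a)\<close> and \<open>1 / (f - b)\<close> are holomorphic on a full
  disc. The cross ratio of \<open>f\<close> with the three functions omits 0, 1, \<open>\<infinity>\<close> on the punctured disc, so by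
  Schottky's theorem, along a subsequence either \<open>1 / (f\<^sub>n - a)\<close> is bounded on a small circle
  around \<open>z\<close>, or it tends to \<open>\<infinity>\<close> uniformly there. In the first case it is bounded on the disc by
  the maximum principle, and Montel's theorem applies. In the second case the holomorphic functions
  \<open>u\<^sub>n = (f\<^sub>n - a) / (f\<^sub>n - b) = 1 + (b - a) / (f\<^sub>n - b)\<close> tend to 0 on the circle, hence on the disc.
  This is impossible if \<open>a z = b z\<close>, since then \<open>u\<^sub>n z = 1\<close>; otherwise it bounds \<open>1 / (f\<^sub>n - b)\<close> near
  \<open>z\<close>, and Montel's theorem applies again. A diagonal argument makes the convergence global.\<close>

section \<open>Homogeneous coordinates on the sphere\<close>

text \<open>The point with homogeneous coordinates [p : q]. The pair (0, 0) falls to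
  \<open>None\<close> by default, so statements about general pairs exclude it.\<close>

definition proj :: "complex \<Rightarrow> complex \<Rightarrow> complex option" where
  "proj p q = (if q = 0 then None else Some (p / q))"

lemma proj_exhaust:
  obtains p q where "x = proj p q" "p \<noteq> 0 \<or> q \<noteq> 0"
proof (cases x)
  case None
  show ?thesis by (rule that[of 1 0]) (simp_all add: None proj_def)
next
  case (Some a)
  show ?thesis by (rule that[of a 1]) (simp_all add: Some proj_def)
qed

lemma proj_eq_iff:
  assumes "p \<noteq> 0 \<or> q \<noteq> 0" "p' \<noteq> 0 \<or> q' \<noteq> 0"
  shows "proj p q = proj p' q' \<longleftrightarrow> p * q' = p' * q"
  using assms by (auto simp: proj_def frac_eq_eq)

lemma sqrt_one_plus_cmod_divide:
  assumes "q \<noteq> 0"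
  shows "sqrt (1 + (cmod (p / q))\<^sup>2) = sqrt ((cmod p)\<^sup>2 + (cmod q)\<^sup>2) / cmod q"
proof -
  have "1 + (cmod (p / q))\<^sup>2 = ((cmod p)\<^sup>2 + (cmod q)\<^sup>2) / (cmod q)\<^sup>2"
    using assms by (simp add: norm_divide power_divide field_simps)
  then show ?thesis by (simp add: real_sqrt_divide)
qed

text \<open>Clearing denominators turns 1 + |p/q|^2 into the squared norm of (p, q) over |q|^2; the
  factors |q| cancel, and one determinant formula covers infinity too. It shows how linear maps act
  on the distance.\<close>

lemma chordal_proj:
  assumes "p \<noteq> 0 \<or> q \<noteq> 0" "p' \<noteq> 0 \<or> q' \<noteq> 0"
  shows "chordal (proj p q) (proj p' q') =
    2 * cmod (p * q' - p' * q) / (sqrt ((cmod p)\<^sup>2 + (cmod q)\<^sup>2) * sqrt ((cmod p')\<^sup>2 + (cmod q')\<^sup>2))"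
proof -
  have *: "cmod (p / q - p' / q') = cmod (p * q' - p' * q) / (cmod q * cmod q')"
    if "q \<noteq> 0" "q' \<noteq> 0"
    using that by (simp add: diff_frac_eq norm_divide norm_mult)
  consider "q = 0" "q' = 0" | "q = 0" "q' \<noteq> 0" | "q \<noteq> 0" "q' = 0" | "q \<noteq> 0" "q' \<noteq> 0"
    by blast
  then show ?thesis
  proof cases
    case 4
    then show ?thesis
      by (simp add: proj_def sqrt_one_plus_cmod_divide * del: real_sqrt_mult)
  qed (use assms in \<open>auto simp: proj_def sqrt_one_plus_cmod_divide norm_mult\<close>)
qed

section \<open>The chordal distance inside Euclidean space\<close>

text \<open>Inverse stereographic projection onto the unit sphere of R^3, modelled as
  \<open>complex \<times> real\<close>; the height (|a|^2 - 1) / (|a|^2 + 1) is written 1 - 2 / (1 +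
  |a|^2).\<close>

definition stereo :: "complex option \<Rightarrow> complex \<times> real" where
  "stereo x = (case x of None \<Rightarrow> (0, 1)
     | Some a \<Rightarrow> (of_real (2 / (1 + (cmod a)\<^sup>2)) * a, 1 - 2 / (1 + (cmod a)\<^sup>2)))"

lemma chordal_eq_dist: "chordal x y = dist (stereo x) (stereo y)"
proof -
  have chordal_nonneg: "chordal x y \<ge> 0"
    by (cases x; cases y) auto
  define s where "s a = 1 / (1 + (cmod a)\<^sup>2)" for a
  have pos: "1 + (cmod a)\<^sup>2 > 0" for a by (simp add: add_pos_nonneg)
  have s: "s a * (1 + (cmod a)\<^sup>2) = 1" for a
    using pos[of a] by (simp add: s_def)
  \<comment> \<open>The law of cosines removes the inner product of \<open>a\<close> and
    \<open>b\<close>; with \<open>s a * (1 + |a|^2) = 1\<close> only polynomial identities between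
    reals remain.\<close>
  have lin: "(cmod (of_real \<alpha> * a - of_real \<beta> * b))\<^sup>2
      = \<alpha>\<^sup>2 * (cmod a)\<^sup>2 + \<beta>\<^sup>2 * (cmod b)\<^sup>2 - \<alpha> * \<beta> * ((cmod a)\<^sup>2 + (cmod b)\<^sup>2 - (cmod (a - b))\<^sup>2)"
    for a b \<alpha> \<beta>
    unfolding cmod_power2 by (simp add: power2_eq_square algebra_simps)
  have stereo_Some: "stereo (Some a) = (of_real (2 * s a) * a, 1 - 2 * s a)" for a
    by (simp add: stereo_def s_def)
  have inf: "(2 / sqrt (1 + (cmod a)\<^sup>2))\<^sup>2 = (dist (stereo (Some a)) (0, 1))\<^sup>2" for a
  proof -
    have "(dist (stereo (Some a)) (0, 1))\<^sup>2 = (2 * s a)\<^sup>2 * (cmod a)\<^sup>2 + (2 * s a)\<^sup>2"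
      unfolding stereo_Some dist_Pair_Pair by (simp add: dist_norm norm_mult power_mult_distrib)
    also have "\<dots> = 4 * s a"
      using s[of a] by algebra
    finally show ?thesis using pos[of a] by (simp add: power_divide s_def)
  qed
  have fin: "(chordal (Some a) (Some b))\<^sup>2 = (dist (stereo (Some a)) (stereo (Some b)))\<^sup>2" for a b
  proof -
    have "(dist (stereo (Some a)) (stereo (Some b)))\<^sup>2
        = (cmod (of_real (2 * s a) * a - of_real (2 * s b) * b))\<^sup>2 + (2 * s b - 2 * s a)\<^sup>2"
      unfolding stereo_Some dist_Pair_Pair by (simp add: dist_norm)
    also have "\<dots> = 4 * (cmod (a - b))\<^sup>2 * s a * s b"
      unfolding lin using s[of a] s[of b] by algebra
    finally show ?thesis
      using pos[of a] pos[of b] by (simp add: power_divide power_mult_distrib s_def)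
  qed
  have stereo_None: "stereo None = (0, 1)" by (simp add: stereo_def)
  have stereo_commute: "dist (0, 1) (stereo (Some a)) = dist (stereo (Some a)) (0, 1)" for a
    by (rule dist_commute)
  have "(chordal x y)\<^sup>2 = (dist (stereo x) (stereo y))\<^sup>2"
  proof (cases x; cases y)
    fix a b assume "x = Some a" "y = Some b"
    then show ?thesis by (simp only: fin)
  qed (simp_all only: chordal.simps stereo_None stereo_commute inf dist_self)
  then show ?thesis using chordal_nonneg by (simp add: power2_eq_iff_nonneg)
qed

lemma chordal_eq_0_iff: "chordal x y = 0 \<longleftrightarrow> x = y"
proof -
  have "1 + (cmod a)\<^sup>2 \<noteq> 0" for a
    using zero_le_power2[of "cmod a"] by linarith
  then show ?thesis by (cases x; cases y) simp_all
qed

lemma stereo_eq_iff: "stereo x = stereo y \<longleftrightarrow> x = y"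
  using chordal_eq_0_iff[of x y] by (simp add: chordal_eq_dist)

section \<open>Rotations of the sphere\<close>

text \<open>The matrix \<open>(1, t; - t, 1)\<close> is a multiple of a unitary one, hence acts on the sphere
  as a rotation.\<close>

definition rot :: "real \<Rightarrow> complex option \<Rightarrow> complex option" where
  "rot t x = (case x of None \<Rightarrow> proj 1 (- of_real t) | Some a \<Rightarrow> proj (a + of_real t) (1 - of_real t * a))"

text \<open>This is the determinant of the matrix behind \<open>rot t\<close>, and it is positive
  for real \<open>t\<close>.\<close>

lemma one_plus_of_real_square_neq_0: "1 + complex_of_real t * of_real t \<noteq> 0"
proof -
  have "1 + t * t > 0" by (simp add: add_pos_nonneg)
  moreover have "1 + complex_of_real t * of_real t = of_real (1 + t * t)" by simp
  ultimately show ?thesis by (simp only: of_real_eq_0_iff)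
qed

lemma rot_coords_nonzero:
  fixes p q :: complex
  assumes "p \<noteq> 0 \<or> q \<noteq> 0"
  shows "p + of_real t * q \<noteq> 0 \<or> q - of_real t * p \<noteq> 0"
proof (rule ccontr)
  assume "\<not> ?thesis"
  then have *: "p + of_real t * q = 0" "q - of_real t * p = 0" by blast+
  then have "q = of_real t * p" by (simp only: right_minus_eq)
  with *(1) have "p + of_real t * (of_real t * p) = 0" by (simp only:)
  then have "(1 + of_real t * of_real t) * p = 0" by (simp only: distrib_right mult_1_left mult.assoc)
  then have "p = 0" by (simp only: mult_eq_0_iff one_plus_of_real_square_neq_0 simp_thms)
  then show False using assms \<open>q = of_real t * p\<close> by (metis mult_zero_right)
qed

lemma rot_proj:
  assumes "p \<noteq> 0 \<or> q \<noteq> 0"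
  shows "rot t (proj p q) = proj (p + of_real t * q) (q - of_real t * p)"
proof (cases "q = 0")
  case True
  then show ?thesis using assms by (auto simp: rot_def proj_def)
next
  case False
  then have "p / q + of_real t = (p + of_real t * q) / q" "1 - of_real t * (p / q) = (q - of_real t * p) / q"
    by (simp_all add: field_simps)
  then show ?thesis using False by (simp add: rot_def proj_def)
qed

text \<open>The determinant in \<open>chordal_proj\<close> is multiplied by 1 + t^2 and each of the
  two norms by its square root, so the factors cancel.\<close>

lemma chordal_rot: "chordal (rot t x) (rot t y) = chordal x y"
proof -
  obtain p q where x: "x = proj p q" "p \<noteq> 0 \<or> q \<noteq> 0" by (rule proj_exhaust)
  obtain p' q' where y: "y = proj p' q'" "p' \<noteq> 0 \<or> q' \<noteq> 0" by (rule proj_exhaust)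
  have N: "(cmod (u + of_real t * v))\<^sup>2 + (cmod (v - of_real t * u))\<^sup>2
      = (1 + t\<^sup>2) * ((cmod u)\<^sup>2 + (cmod v)\<^sup>2)" for u v
    unfolding cmod_power2 by (simp add: power2_eq_square algebra_simps)
  have D: "(p + of_real t * q) * (q' - of_real t * p') - (p' + of_real t * q') * (q - of_real t * p)
      = of_real (1 + t\<^sup>2) * (p * q' - p' * q)"
    by (simp add: power2_eq_square algebra_simps)
  define S where "S = sqrt (1 + t\<^sup>2)"
  have pos: "1 + t\<^sup>2 > 0" by (simp add: add_pos_nonneg)
  then have S: "S > 0" "\<bar>1 + t\<^sup>2\<bar> = S * S" by (simp_all add: S_def)
  have cancel: "2 * (S * S * c) / (S * X * (S * Y)) = 2 * c / (X * Y)" for c X Y :: real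
  proof -
    have "2 * (S * S * c) / (S * X * (S * Y)) = (S * S * (2 * c)) / (S * S * (X * Y))"
      by (simp only: mult_ac)
    then show ?thesis using S(1) by simp
  qed
  have "chordal (rot t x) (rot t y) = 2 * cmod (of_real (1 + t\<^sup>2) * (p * q' - p' * q)) /
      (sqrt ((1 + t\<^sup>2) * ((cmod p)\<^sup>2 + (cmod q)\<^sup>2)) * sqrt ((1 + t\<^sup>2) * ((cmod p')\<^sup>2 + (cmod q')\<^sup>2)))"
    unfolding x(1) y(1) rot_proj[OF x(2)] rot_proj[OF y(2)]
    by (subst chordal_proj[OF rot_coords_nonzero[OF x(2)] rot_coords_nonzero[OF y(2)]])
      (simp only: N D)
  also have "\<dots> = 2 * cmod (p * q' - p' * q) /
      (sqrt ((cmod p)\<^sup>2 + (cmod q)\<^sup>2) * sqrt ((cmod p')\<^sup>2 + (cmod q')\<^sup>2))"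
    unfolding norm_mult[of "of_real (1 + t\<^sup>2)"] norm_of_real S(2) real_sqrt_mult S_def[symmetric]
    by (rule cancel)
  also have "\<dots> = chordal x y"
    unfolding x(1) y(1) by (rule chordal_proj[OF x(2) y(2), symmetric])
  finally show ?thesis .
qed

lemma rot_eq_iff: "rot t x = rot t y \<longleftrightarrow> x = y"
  by (metis chordal_eq_0_iff chordal_rot)

text \<open>The matrices for \<open>t\<close> and \<open>- t\<close> multiply to 1 + t^2 times the
  identity, and homogeneous coordinates ignore scalars.\<close>

lemma rot_minus_rot: "rot (- t) (rot t x) = x"
proof -
  obtain p q where x: "x = proj p q" "p \<noteq> 0 \<or> q \<noteq> 0" by (rule proj_exhaust)
  define c where "c = 1 + complex_of_real t * of_real t"
  have "p + of_real t * q + of_real (- t) * (q - of_real t * p) = c * p"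
    "q - of_real t * p - of_real (- t) * (p + of_real t * q) = c * q"
    by (simp_all add: c_def algebra_simps)
  moreover have "c \<noteq> 0"
    using one_plus_of_real_square_neq_0 by (simp add: c_def)
  ultimately show ?thesis
    unfolding x(1) rot_proj[OF x(2)] rot_proj[OF rot_coords_nonzero[OF x(2)]]
    by (simp add: proj_def)
qed

text \<open>Each point is sent to \<open>\<infinity>\<close> by at most one nonzero \<open>t\<close>.\<close>

lemma rot_finite_exists: "\<exists>t. rot t x \<noteq> None \<and> rot t y \<noteq> None"
proof (rule ccontr)
  assume "\<not> ?thesis"
  then have *: "rot t x = None \<or> rot t y = None" for t by blast
  have uniq: "s = t" if "s \<noteq> 0" "t \<noteq> 0" "rot s z = None" "rot t z = None" for s t z
  proof (cases z)
    case None
    then show ?thesis using that by (simp add: rot_def proj_def)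
  next
    case (Some a)
    then have "of_real s * a = 1" "of_real t * a = 1"
      using that by (auto simp: rot_def proj_def split: if_splits)
    then show ?thesis by (metis mult_cancel_right mult_zero_right of_real_eq_iff zero_neq_one)
  qed
  \<comment> \<open>Three parameters suffice, since \<open>x\<close> and \<open>y\<close> can each
    rule out at most one of 1, 2, 3.\<close>
  have "\<not> (rot 1 z = None \<and> rot 2 z = None)" "\<not> (rot 1 z = None \<and> rot 3 z = None)"
    "\<not> (rot 2 z = None \<and> rot 3 z = None)" for z
    using uniq[of 1 2 z] uniq[of 1 3 z] uniq[of 2 3 z] by fastforce+
  then show False
    using *[of 1] *[of 2] *[of 3] by blast
qed

section \<open>Holomorphic maps to the sphere\<close>

text \<open>Unlike \<open>mero_on\<close>, this notion is local, invariant under rotations of the sphere and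
  satisfied by the constant \<open>\<infinity>\<close>.\<close>

definition sphere_holo :: "(complex \<Rightarrow> complex option) \<Rightarrow> complex set \<Rightarrow> bool" where
  "sphere_holo f S \<longleftrightarrow> (\<forall>z\<in>S. \<exists>U p q. open U \<and> z \<in> U \<and> p holomorphic_on U \<and> q holomorphic_on U \<and>
     (\<forall>w\<in>U. (p w \<noteq> 0 \<or> q w \<noteq> 0) \<and> f w = proj (p w) (q w)))"

lemma sphere_holoI:
  assumes "\<And>z. z \<in> S \<Longrightarrow> \<exists>U p q. open U \<and> z \<in> U \<and> p holomorphic_on U \<and> q holomorphic_on U \<and>
     (\<forall>w\<in>U. (p w \<noteq> 0 \<or> q w \<noteq> 0) \<and> f w = proj (p w) (q w))"
  shows "sphere_holo f S"
  using assms by (simp add: sphere_holo_def)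

lemma sphere_holoE:
  assumes "sphere_holo f S" "open S" "z \<in> S"
  obtains r p q where "r > 0" "ball z r \<subseteq> S" "p holomorphic_on ball z r" "q holomorphic_on ball z r"
    "\<And>w. w \<in> ball z r \<Longrightarrow> p w \<noteq> 0 \<or> q w \<noteq> 0" "\<And>w. w \<in> ball z r \<Longrightarrow> f w = proj (p w) (q w)"
proof -
  obtain U p q where U: "open U" "z \<in> U" "p holomorphic_on U" "q holomorphic_on U"
    "\<forall>w\<in>U. (p w \<noteq> 0 \<or> q w \<noteq> 0) \<and> f w = proj (p w) (q w)"
    using assms unfolding sphere_holo_def by blast
  obtain r where r: "r > 0" "ball z r \<subseteq> U \<inter> S"
    using U(1,2) assms(2,3) by (meson IntI open_Int open_contains_ball_eq)
  show thesis
    by (rule that[of r p q]) (use U r in \<open>auto intro: holomorphic_on_subset\<close>)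
qed

lemma sphere_holo_subset: "sphere_holo f S \<Longrightarrow> T \<subseteq> S \<Longrightarrow> sphere_holo f T"
  by (auto simp: sphere_holo_def)

lemma sphere_holo_local:
  assumes "\<And>z. z \<in> S \<Longrightarrow> \<exists>U g. open U \<and> z \<in> U \<and> sphere_holo g U \<and> (\<forall>w\<in>U. f w = g w)"
  shows "sphere_holo f S"
proof (rule sphere_holoI)
  fix z assume "z \<in> S"
  from assms[OF this] obtain U g where U: "open U" "z \<in> U" "sphere_holo g U" "\<And>w. w \<in> U \<Longrightarrow> f w = g w"
    by blast
  obtain r p q where *: "r > 0" "ball z r \<subseteq> U" "p holomorphic_on ball z r" "q holomorphic_on ball z r"
    "\<And>w. w \<in> ball z r \<Longrightarrow> p w \<noteq> 0 \<or> q w \<noteq> 0" "\<And>w. w \<in> ball z r \<Longrightarrow> g w = proj (p w) (q w)"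
    using sphere_holoE[OF U(3,1,2)] by blast
  show "\<exists>U p q. open U \<and> z \<in> U \<and> p holomorphic_on U \<and> q holomorphic_on U \<and>
     (\<forall>w\<in>U. (p w \<noteq> 0 \<or> q w \<noteq> 0) \<and> f w = proj (p w) (q w))"
  proof (intro exI conjI ballI)
    show "z \<in> ball z r" using *(1) by simp
    show "f w = proj (p w) (q w)" if "w \<in> ball z r" for w
      using *(6)[OF that] U(4)[of w] *(2) that by auto
  qed (use * in auto)
qed

lemma sphere_holo_None: "sphere_holo (\<lambda>z. None) S"
proof (rule sphere_holoI)
  fix z
  show "\<exists>U p q. open U \<and> z \<in> U \<and> p holomorphic_on U \<and> q holomorphic_on U \<and>
     (\<forall>w\<in>U. (p w \<noteq> 0 \<or> q w \<noteq> 0) \<and> None = proj (p w) (q w))"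
    by (rule exI[of _ UNIV], rule exI[of _ "\<lambda>_. 1"], rule exI[of _ "\<lambda>_. 0"]) (simp add: proj_def)
qed

lemma sphere_holo_proj:
  assumes "open S" "p holomorphic_on S" "q holomorphic_on S" "\<And>z. z \<in> S \<Longrightarrow> p z \<noteq> 0 \<or> q z \<noteq> 0"
  shows "sphere_holo (\<lambda>z. proj (p z) (q z)) S"
  by (intro sphere_holoI exI[of _ S] exI[of _ p] exI[of _ q] conjI ballI) (use assms in auto)

lemma sphere_holo_rot:
  assumes "sphere_holo f S"
  shows "sphere_holo (\<lambda>z. rot t (f z)) S"
proof (rule sphere_holoI)
  fix z assume "z \<in> S"
  then obtain U p q where U: "open U" "z \<in> U" "p holomorphic_on U" "q holomorphic_on U"
    "\<forall>w\<in>U. (p w \<noteq> 0 \<or> q w \<noteq> 0) \<and> f w = proj (p w) (q w)"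
    using assms unfolding sphere_holo_def by blast
  have "(\<lambda>w. p w + of_real t * q w) holomorphic_on U" "(\<lambda>w. q w - of_real t * p w) holomorphic_on U"
    by (intro holomorphic_intros U)+
  moreover have "\<forall>w\<in>U. (p w + of_real t * q w \<noteq> 0 \<or> q w - of_real t * p w \<noteq> 0) \<and>
      rot t (f w) = proj (p w + of_real t * q w) (q w - of_real t * p w)"
    using U(5) rot_proj rot_coords_nonzero by metis
  ultimately show "\<exists>U p q. open U \<and> z \<in> U \<and> p holomorphic_on U \<and> q holomorphic_on U \<and>
     (\<forall>w\<in>U. (p w \<noteq> 0 \<or> q w \<noteq> 0) \<and> rot t (f w) = proj (p w) (q w))"
    by (intro exI[of _ U] exI[of _ "\<lambda>w. p w + of_real t * q w"] exI[of _ "\<lambda>w. q w - of_real t * p w"])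
      (simp add: U(1,2))
qed

lemma eventually_at_openD:
  fixes z :: "'a :: topological_space"
  assumes "\<forall>\<^sub>F w in at z. P w"
  shows "\<exists>T. open T \<and> z \<in> T \<and> (\<forall>w\<in>T. w \<noteq> z \<longrightarrow> P w)"
  using assms unfolding eventually_at_topological by auto

section \<open>Meromorphic functions as maps to the sphere\<close>

text \<open>Away from poles the coordinates are (f, 1). Around a pole they are (1, 1/f), where 1/f
  extends holomorphically by Riemann's theorem on removable singularities.\<close>

lemma mero_on_imp_sphere_holo:
  assumes "open S" "mero_on f S"
  shows "sphere_holo f S"
proof (rule sphere_holoI)
  fix z assume z: "z \<in> S"
  then have "\<not> z islimpt {w \<in> S. f w = None}"
    using assms(2) unfolding mero_on_def by blast
  then have "\<forall>\<^sub>F w in at z. w \<in> S \<longrightarrow> f w \<noteq> None"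
    by (simp add: islimpt_iff_eventually del: not_None_eq)
  from eventually_at_openD[OF this]
  obtain T where T: "open T" "z \<in> T" "\<forall>w\<in>T. w \<noteq> z \<longrightarrow> w \<in> S \<longrightarrow> f w \<noteq> None"
    by blast
  have hol: "(\<lambda>w. the (f w)) holomorphic_on {w \<in> S. f w \<noteq> None}"
    and pole: "f z = None \<Longrightarrow> filterlim (\<lambda>w. the (f w)) at_infinity (at z)"
    using assms(2) z unfolding mero_on_def by auto
  show "\<exists>U p q. open U \<and> z \<in> U \<and> p holomorphic_on U \<and> q holomorphic_on U \<and>
     (\<forall>w\<in>U. (p w \<noteq> 0 \<or> q w \<noteq> 0) \<and> f w = proj (p w) (q w))"
  proof (cases "f z = None")
    case False
    then have sub: "T \<inter> S \<subseteq> {w \<in> S. f w \<noteq> None}" using T by auto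
    show ?thesis
    proof (rule exI[of _ "T \<inter> S"], rule exI[of _ "\<lambda>w. the (f w)"], rule exI[of _ "\<lambda>w. 1"], intro conjI ballI)
      show "open (T \<inter> S)" using T assms by auto
      show "(\<lambda>w. the (f w)) holomorphic_on T \<inter> S" by (rule holomorphic_on_subset[OF hol sub])
      show "f w = proj (the (f w)) 1" if "w \<in> T \<inter> S" for w
        using sub that by (auto simp: proj_def)
    qed (use T z in auto)
  next
    case True
    have "\<forall>\<^sub>F w in at z. the (f w) \<noteq> 0"
      using filterlim_at_infinity_imp_eventually_ne[OF pole[OF True]] .
    from eventually_at_openD[OF this]
    obtain V where V: "open V" "z \<in> V" "\<forall>w\<in>V. w \<noteq> z \<longrightarrow> the (f w) \<noteq> 0"
      by blast
    define U where "U = T \<inter> V \<inter> S"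
    have U: "open U" "z \<in> U" using T V z assms by (auto simp: U_def)
    \<comment> \<open>The value 0 at \<open>z\<close> is the limit of 1/f at the pole, which makes
      \<open>q\<close> continuous there.\<close>
    define q where "q w = (if w = z then 0 else inverse (the (f w)))" for w
    have sub: "U - {z} \<subseteq> {w \<in> S. f w \<noteq> None}" using T by (auto simp: U_def)
    have "q holomorphic_on U - {z}"
    proof (rule holomorphic_transform)
      show "(\<lambda>w. inverse (the (f w))) holomorphic_on U - {z}"
        by (intro holomorphic_intros holomorphic_on_subset[OF hol sub]) (use V in \<open>auto simp: U_def\<close>)
    qed (simp add: q_def)
    moreover have "(q \<longlongrightarrow> q z) (at z within U)"
    proof -
      have "((\<lambda>w. inverse (the (f w))) \<longlongrightarrow> 0) (at z)"
        using pole[OF True] tendsto_inverse_0 filterlim_compose by blast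
      then have "(q \<longlongrightarrow> 0) (at z)"
        by (rule Lim_transform_eventually) (simp add: q_def eventually_at_filter)
      then show ?thesis using Lim_at_imp_Lim_at_within by (auto simp: q_def)
    qed
    ultimately have hq: "q holomorphic_on U"
      using U(1) by (intro no_isolated_singularity'[where K = "{z}" and f = q and S = U]) simp_all
    have fq: "f w = proj 1 (q w)" if "w \<in> U" for w
      using that V(3) T(3) True by (cases "w = z"; cases "f w") (auto simp: U_def proj_def q_def divide_inverse)
    show ?thesis
      by (rule exI[of _ U], rule exI[of _ "\<lambda>w. 1"], rule exI[of _ q]) (simp add: U hq fq)
  qed
qed

section \<open>The identity theorem on the sphere and isolated poles\<close>

text \<open>\<open>f\<close> and \<open>g\<close> agree exactly at the zeros of the determinant
  \<open>W\<close> of their coordinates. On a disc the holomorphic \<open>W\<close> vanishes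
  identically or has isolated zeros.\<close>

lemma sphere_holo_eq_or_neq_near:
  assumes "sphere_holo f S" "sphere_holo g S" "open S" "z \<in> S"
  shows "(\<forall>\<^sub>F w in nhds z. f w = g w) \<or> (\<forall>\<^sub>F w in at z. f w \<noteq> g w)"
proof -
  obtain r p q where f: "r > 0" "p holomorphic_on ball z r" "q holomorphic_on ball z r"
    "\<And>w. w \<in> ball z r \<Longrightarrow> p w \<noteq> 0 \<or> q w \<noteq> 0" "\<And>w. w \<in> ball z r \<Longrightarrow> f w = proj (p w) (q w)"
    using sphere_holoE[OF assms(1,3,4)] by metis
  obtain r' p' q' where g: "r' > 0" "p' holomorphic_on ball z r'" "q' holomorphic_on ball z r'"
    "\<And>w. w \<in> ball z r' \<Longrightarrow> p' w \<noteq> 0 \<or> q' w \<noteq> 0" "\<And>w. w \<in> ball z r' \<Longrightarrow> g w = proj (p' w) (q' w)"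
    using sphere_holoE[OF assms(2,3,4)] by metis
  define B where "B = ball z (min r r')"
  define W where "W w = p w * q' w - p' w * q w" for w
  have B: "open B" "connected B" "z \<in> B" "B \<subseteq> ball z r" "B \<subseteq> ball z r'"
    using f(1) g(1) by (auto simp: B_def)
  have W: "W holomorphic_on B"
    unfolding W_def by (intro holomorphic_intros f(2,3)[THEN holomorphic_on_subset] g(2,3)[THEN holomorphic_on_subset] B)
  have eq: "f w = g w \<longleftrightarrow> W w = 0" if "w \<in> B" for w
  proof -
    have w: "w \<in> ball z r" "w \<in> ball z r'" using that B by blast+
    show ?thesis
      unfolding f(5)[OF w(1)] g(5)[OF w(2)] proj_eq_iff[OF f(4)[OF w(1)] g(4)[OF w(2)]] W_def
      by simp
  qed
  have nhds: "\<forall>\<^sub>F w in nhds z. w \<in> B" using B by (intro eventually_nhds_in_open)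
  then have at: "\<forall>\<^sub>F w in at z. w \<in> B" by (simp add: eventually_at_filter eventually_mono)
  show ?thesis
  proof (cases "\<exists>\<beta>\<in>B. W \<beta> \<noteq> 0")
    case False
    then have "\<forall>\<^sub>F w in nhds z. f w = g w"
      using eq by (intro eventually_mono[OF nhds]) blast
    then show ?thesis ..
  next
    case True
    have "\<forall>\<^sub>F w in at z. W w \<noteq> 0"
    proof (cases "W z = 0")
      case 0: True
      from True obtain \<beta> where "\<beta> \<in> B" "W \<beta> \<noteq> 0" by blast
      then obtain e where "e > 0" "\<And>w. w \<in> ball z e - {z} \<Longrightarrow> W w \<noteq> 0"
        using isolated_zeros[OF W B(1-3) 0] by blast
      then show ?thesis
        unfolding eventually_at by (intro exI[of _ e]) (auto simp: dist_commute)
    next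
      case False
      have "isCont W z"
        using W B holomorphic_on_imp_continuous_on continuous_on_eq_continuous_at by blast
      then show ?thesis
        using False by (metis continuous_at tendsto_imp_eventually_ne)
    qed
    with at have "\<forall>\<^sub>F w in at z. f w \<noteq> g w"
      by eventually_elim (use eq in auto)
    then show ?thesis ..
  qed
qed

text \<open>The points near which the maps agree and those near which they differ off the centre
  form disjoint open sets covering \<open>S\<close>, so connectedness selects one of them.\<close>

lemma sphere_holo_eq_or_isolated:
  assumes "sphere_holo f S" "sphere_holo g S" "open S" "connected S"
  shows "(\<forall>z\<in>S. f z = g z) \<or> (\<forall>z\<in>S. \<forall>\<^sub>F w in at z. f w \<noteq> g w)"
proof -
  define A where "A = {z. \<forall>\<^sub>F w in nhds z. f w = g w}"
  define B where "B = {z. \<forall>\<^sub>F w in at z. f w \<noteq> g w}"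
  have "open A"
  proof (subst open_subopen, rule ballI)
    fix z assume "z \<in> A"
    from this[unfolded A_def mem_Collect_eq eventually_nhds]
    obtain T where T: "open T" "z \<in> T" "\<forall>w\<in>T. f w = g w" by blast
    then have "T \<subseteq> A" unfolding A_def eventually_nhds by blast
    then show "\<exists>T. open T \<and> z \<in> T \<and> T \<subseteq> A" using T(1,2) by blast
  qed
  moreover have "open B"
  proof (subst open_subopen, rule ballI)
    fix z assume "z \<in> B"
    then have "\<forall>\<^sub>F w in at z. f w \<noteq> g w" by (simp add: B_def)
    from eventually_at_openD[OF this]
    obtain T where T: "open T" "z \<in> T" "\<forall>w\<in>T. w \<noteq> z \<longrightarrow> f w \<noteq> g w"
      by blast
    have "w \<in> B" if "w \<in> T" for w
    proof (cases "w = z")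
      case True
      then show ?thesis using \<open>z \<in> B\<close> by simp
    next
      case False
      then have "open (T - {z})" "w \<in> T - {z}" using T that by auto
      then show ?thesis
        unfolding B_def mem_Collect_eq eventually_at_topological using T(3) by blast
    qed
    then show "\<exists>T. open T \<and> z \<in> T \<and> T \<subseteq> B" using T(1,2) by blast
  qed
  moreover have "A \<inter> B = {}"
  proof -
    have False if "z \<in> A" "z \<in> B" for z
    proof -
      have "\<forall>\<^sub>F w in at z. f w = g w"
        using that(1) by (simp add: A_def eventually_at_filter eventually_mono)
      moreover have "\<forall>\<^sub>F w in at z. f w \<noteq> g w"
        using that(2) by (simp add: B_def)
      ultimately have "\<forall>\<^sub>F w in at z. False" by eventually_elim simp
      then show False by simp
    qed
    then show ?thesis by blast
  qed
  moreover have "S \<subseteq> A \<union> B"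
    using sphere_holo_eq_or_neq_near[OF assms(1-3)] by (auto simp: A_def B_def)
  ultimately have "A \<inter> S = {} \<or> B \<inter> S = {}"
    using connectedD[OF assms(4), of A B] by blast
  then have "S \<subseteq> A \<or> S \<subseteq> B" using \<open>S \<subseteq> A \<union> B\<close> by blast
  then show ?thesis
    by (auto simp: A_def B_def dest: eventually_nhds_x_imp_x)
qed

lemma holomorphic_on_local:
  assumes "\<And>z. z \<in> S \<Longrightarrow> \<exists>U g. open U \<and> z \<in> U \<and> g holomorphic_on U \<and> (\<forall>w\<in>U. f w = g w)"
  shows "f holomorphic_on S"
  unfolding holomorphic_on_def
proof
  fix z assume "z \<in> S"
  from assms[OF this] obtain U g where U: "open U" "z \<in> U" "g holomorphic_on U" "\<And>w. w \<in> U \<Longrightarrow> f w = g w"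
    by blast
  have "f holomorphic_on U" by (rule holomorphic_transform[OF U(3)]) (simp add: U(4))
  then show "f field_differentiable at z within S"
    using U holomorphic_on_imp_differentiable_at field_differentiable_at_within by blast
qed

text \<open>Poles are coincidences with the constant map to infinity, hence isolated by the identity
  theorem unless \<open>f\<close> is infinite on all of \<open>S\<close>.\<close>

lemma sphere_holo_imp_mero_on:
  assumes "sphere_holo f S" "open S" "connected S"
  shows "mero_on f S \<or> (\<forall>z\<in>S. f z = None)"
proof (rule disjCI)
  assume "\<not> (\<forall>z\<in>S. f z = None)"
  then have iso: "\<forall>\<^sub>F w in at z. f w \<noteq> None" if "z \<in> S" for z
    using sphere_holo_eq_or_isolated[OF assms(1) sphere_holo_None assms(2,3)] that by blast
  show "mero_on f S"
    unfolding mero_on_def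
  proof (intro conjI ballI impI)
    fix z assume "z \<in> S"
    then show "\<not> z islimpt {w \<in> S. f w = None}"
      using iso[of z] by (auto simp: islimpt_def eventually_at_topological)
  next
    show "(\<lambda>z. the (f z)) holomorphic_on {w \<in> S. f w \<noteq> None}"
    proof (rule holomorphic_on_local)
      fix z assume z: "z \<in> {w \<in> S. f w \<noteq> None}"
      then obtain r p q where f: "r > 0" "p holomorphic_on ball z r" "q holomorphic_on ball z r"
        "\<And>w. w \<in> ball z r \<Longrightarrow> p w \<noteq> 0 \<or> q w \<noteq> 0" "\<And>w. w \<in> ball z r \<Longrightarrow> f w = proj (p w) (q w)"
        using sphere_holoE[OF assms(1,2)] by (metis (no_types, lifting) mem_Collect_eq)
      define U where "U = {w \<in> ball z r. q w \<in> - {0}}"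
      have "open U"
        unfolding U_def using f(3) holomorphic_on_imp_continuous_on
        by (intro continuous_open_preimage[unfolded vimage_def Int_def, simplified]) auto
      moreover have "z \<in> U"
        using z f(1) f(5)[of z] by (auto simp: U_def proj_def)
      moreover have "(\<lambda>w. p w / q w) holomorphic_on U"
        by (intro holomorphic_intros f(2,3)[THEN holomorphic_on_subset]) (auto simp: U_def)
      moreover have "\<forall>w\<in>U. the (f w) = p w / q w"
        using f(5) by (auto simp: U_def proj_def)
      ultimately show "\<exists>U g. open U \<and> z \<in> U \<and> g holomorphic_on U \<and> (\<forall>w\<in>U. the (f w) = g w)"
        by blast
    qed
  next
    fix z assume z: "z \<in> S" "f z = None"
    then obtain r p q where f: "r > 0" "p holomorphic_on ball z r" "q holomorphic_on ball z r"
      "\<And>w. w \<in> ball z r \<Longrightarrow> p w \<noteq> 0 \<or> q w \<noteq> 0" "\<And>w. w \<in> ball z r \<Longrightarrow> f w = proj (p w) (q w)"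
      using sphere_holoE[OF assms(1,2)] by metis
    have B: "z \<in> ball z r" using f(1) by simp
    have qz: "q z = 0" using f(5)[OF B] z(2) by (simp add: proj_def split: if_splits)
    then have pz: "p z \<noteq> 0" using f(4)[OF B] by simp
    have ev: "\<forall>\<^sub>F w in at z. w \<in> ball z r"
      using B by (intro eventually_at_in_open') auto
    have "isCont p z" "isCont q z"
      using f(2,3) B by (meson continuous_on_eq_continuous_at holomorphic_on_imp_continuous_on open_ball)+
    then have lim: "(p \<longlongrightarrow> p z) (at z)" "(q \<longlongrightarrow> 0) (at z)"
      using qz by (auto simp: continuous_at)
    have "\<forall>\<^sub>F w in at z. q w \<noteq> 0"
      using iso[OF z(1)] ev by eventually_elim (use f(5) in \<open>auto simp: proj_def\<close>)
    then have "filterlim q (at 0) (at z)"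
      using lim(2) by (simp add: filterlim_at)
    then have "filterlim (\<lambda>w. p w / q w) at_infinity (at z)"
      using lim(1) pz by (intro filterlim_divide_at_infinity)
    moreover have "\<forall>\<^sub>F w in at z. p w / q w = the (f w)"
      using iso[OF z(1)] ev by eventually_elim (use f(5) in \<open>auto simp: proj_def split: if_splits\<close>)
    ultimately show "filterlim (\<lambda>w. the (f w)) at_infinity (at z)"
      using filterlim_cong by force
  qed
qed

section \<open>The coordinate 1 / (x - a)\<close>

text \<open>The Moebius coordinate that sends \<open>a\<close> to infinity and infinity to 0. At
  \<open>Some a\<close> it takes the default value \<open>inverse 0 = 0\<close>, hence the
  hypotheses below that exclude this point.\<close>

definition recip_diff :: "complex option \<Rightarrow> complex \<Rightarrow> complex" where
  "recip_diff x a = (case x of None \<Rightarrow> 0 | Some w \<Rightarrow> inverse (w - a))"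

lemma recip_diff_proj:
  assumes "p \<noteq> 0 \<or> q \<noteq> 0"
  shows "recip_diff (proj p q) a = q / (p - a * q)"
proof (cases "q = 0")
  case False
  then have "p / q - a = (p - a * q) / q" by (simp add: field_simps)
  then show ?thesis using False by (simp add: recip_diff_def proj_def)
qed (simp add: recip_diff_def proj_def)

lemma recip_diff_inject:
  assumes "x \<noteq> Some a" "y \<noteq> Some a"
  shows "recip_diff x a = recip_diff y a \<longleftrightarrow> x = y"
  using assms by (cases x; cases y) (auto simp: recip_diff_def)

text \<open>Solving g = 1 / (x - a) gives x = (1 + a g) / g, which in homogeneous form also covers g
  = 0.\<close>

lemma proj_recip_diff:
  assumes "x \<noteq> Some a"
  shows "x = proj (1 + a * recip_diff x a) (recip_diff x a)"
  using assms by (cases x) (auto simp: recip_diff_def proj_def field_simps)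

text \<open>With f = [p : q] the coordinate is q / (p - a q), whose denominator vanishes only where
  \<open>f\<close> meets \<open>a\<close>. Poles of \<open>f\<close> simply become zeros.\<close>

lemma holomorphic_on_recip_diff:
  assumes "open S" "sphere_holo f S" "a holomorphic_on S" "\<And>z. z \<in> S \<Longrightarrow> f z \<noteq> Some (a z)"
  shows "(\<lambda>z. recip_diff (f z) (a z)) holomorphic_on S"
proof (rule holomorphic_on_local)
  fix z assume "z \<in> S"
  then obtain r p q where f: "r > 0" "ball z r \<subseteq> S" "p holomorphic_on ball z r" "q holomorphic_on ball z r"
    "\<And>w. w \<in> ball z r \<Longrightarrow> p w \<noteq> 0 \<or> q w \<noteq> 0" "\<And>w. w \<in> ball z r \<Longrightarrow> f w = proj (p w) (q w)"
    using sphere_holoE[OF assms(2,1)] by metis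
  have nz: "p w - a w * q w \<noteq> 0" if "w \<in> ball z r" for w
  proof
    assume "p w - a w * q w = 0"
    then have "p w = a w * q w" by simp
    then have "f w = Some (a w)" using f(5,6)[OF that] by (auto simp: proj_def)
    then show False using assms(4) f(2) that by blast
  qed
  have "(\<lambda>w. q w / (p w - a w * q w)) holomorphic_on ball z r"
    by (intro holomorphic_intros f(3,4) holomorphic_on_subset[OF assms(3) f(2)] nz)
  moreover have "\<forall>w\<in>ball z r. recip_diff (f w) (a w) = q w / (p w - a w * q w)"
    using f(5,6) by (simp add: recip_diff_proj)
  ultimately show "\<exists>U g. open U \<and> z \<in> U \<and> g holomorphic_on U \<and> (\<forall>w\<in>U. recip_diff (f w) (a w) = g w)"
    using f(1) by (meson centre_in_ball open_ball)
qed

section \<open>Local normality\<close>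

text \<open>Pulling back along \<open>\<zeta> \<mapsto> z + (w - z) exp (20 \<zeta>)\<close> puts a whole circle into the disc of
  radius 1/2, so one application of Schottky's theorem suffices.\<close>

lemma Schottky_circle:
  assumes hol: "h holomorphic_on ball z R - {z}"
    and omit: "\<And>u. u \<in> ball z R - {z} \<Longrightarrow> h u \<noteq> 0 \<and> h u \<noteq> 1"
    and \<rho>: "0 < \<rho>" "\<rho> * exp 20 < R"
    and w: "w \<in> sphere z \<rho>" "norm (h w) \<le> B"
    and v: "v \<in> sphere z \<rho>"
  shows "norm (h v) \<le> exp (pi * exp (pi * (14 + 2 * B)))"
proof -
  define e where "e \<zeta> = z + (w - z) * exp (20 * \<zeta>)" for \<zeta>
  have nw: "norm (w - z) = \<rho>" using w(1) by (simp add: dist_norm norm_minus_commute)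
  have nv: "norm (v - z) = \<rho>" using v by (simp add: dist_norm norm_minus_commute)
  have e: "e \<zeta> \<in> ball z R - {z}" if "\<zeta> \<in> cball 0 1" for \<zeta>
  proof -
    have "Re \<zeta> \<le> 1" using that complex_Re_le_cmod[of \<zeta>] by simp
    then have "norm (e \<zeta> - z) \<le> \<rho> * exp 20"
      unfolding e_def using \<rho>(1) by (simp add: norm_mult nw)
    moreover have "e \<zeta> \<noteq> z" using nw \<rho>(1) by (auto simp: e_def)
    ultimately show ?thesis using \<rho>(2) by (simp add: dist_norm norm_minus_commute)
  qed
  have S1: "(h \<circ> e) holomorphic_on cball 0 1"
  proof (rule holomorphic_on_compose_gen[OF _ hol])
    show "e holomorphic_on cball 0 1" unfolding e_def by (intro holomorphic_intros)
    show "e ` cball 0 1 \<subseteq> ball z R - {z}" using e by blast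
  qed
  have S2: "norm ((h \<circ> e) 0) \<le> B" using w(2) by (simp add: e_def)
  have S3: "\<not> ((h \<circ> e) \<zeta> = 0 \<or> (h \<circ> e) \<zeta> = 1)" if "\<zeta> \<in> cball 0 1" for \<zeta>
    using omit[OF e[OF that]] by simp
  define u where "u = (v - z) / (w - z)"
  have u: "norm u = 1" using nw nv \<rho>(1) by (simp add: u_def norm_divide)
  then have u0: "u \<noteq> 0" by auto
  \<comment> \<open>As |u| = 1, the logarithm is purely imaginary of modulus at most pi < 4; a
    twentieth of it lies within radius 1/2.\<close>
  define \<zeta> where "\<zeta> = Ln u / 20"
  have "norm (Ln u) \<le> \<bar>Re (Ln u)\<bar> + \<bar>Im (Ln u)\<bar>" by (rule cmod_le)
  also have "\<dots> \<le> 4"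
    using u u0 mpi_less_Im_Ln[OF u0] Im_Ln_le_pi[OF u0] pi_less_4 by (simp add: abs_le_iff)
  finally have "norm \<zeta> \<le> 1 / 2" by (simp add: \<zeta>_def norm_divide)
  \<comment> \<open>At radius 1/2 the last summand is 12, which with 2 gives the constant
    14.\<close>
  then have "norm ((h \<circ> e) \<zeta>) \<le> exp (pi * exp (pi * (2 + 2 * B + 12 * (1/2) / (1 - 1/2))))"
    by (intro Schottky[OF S1 S2 S3]) simp_all
  moreover have "e \<zeta> = v"
  proof -
    have "w - z \<noteq> 0" using nw \<rho>(1) by auto
    then show ?thesis using u0 by (simp add: e_def \<zeta>_def u_def)
  qed
  ultimately show ?thesis by (simp add: add.commute add.left_commute)
qed

lemma norm_le_on_cball_if_on_sphere:
  assumes "f holomorphic_on ball z R" "0 < \<rho>" "\<rho> < R"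
    and "\<And>w. w \<in> sphere z \<rho> \<Longrightarrow> norm (f w) \<le> B" and "w \<in> cball z \<rho>"
  shows "norm (f w) \<le> B"
proof (rule maximum_modulus_frontier[where S = "cball z \<rho>" and f = f])
  show "f holomorphic_on interior (cball z \<rho>)"
    using assms(3) by (intro holomorphic_on_subset[OF assms(1)]) auto
  have "f holomorphic_on cball z \<rho>"
    using assms(3) by (intro holomorphic_on_subset[OF assms(1)]) auto
  then show "continuous_on (closure (cball z \<rho>)) f"
    by (simp add: holomorphic_on_imp_continuous_on)
qed (use assms(4,5) in auto)

lemma holomorphic_on_compact_norm_le:
  assumes "f holomorphic_on S" "compact K" "K \<subseteq> S"
  shows "\<exists>M>0. \<forall>w\<in>K. norm (f w) \<le> M"
proof -
  have "continuous_on K f"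
    using assms(1,3) holomorphic_on_imp_continuous_on continuous_on_subset by blast
  from compact_imp_bounded[OF compact_continuous_image[OF this assms(2)]]
  show ?thesis by (auto simp: bounded_pos)
qed

text \<open>If |g| is below the bound, then |a g| is at most 1/2 and 1 + a g is not small. This
  controls the denominators of the chordal formula.\<close>

lemma recip_coords_norm_ge:
  fixes a g :: complex
  assumes "norm a \<le> M"
  shows "1 / (2 * (M + 1)) \<le> sqrt ((norm (1 + a * g))\<^sup>2 + (norm g)\<^sup>2)"
proof -
  have M: "M \<ge> 0" using assms norm_ge_zero order_trans by blast
  show ?thesis
  proof (cases "norm g \<ge> 1 / (2 * (M + 1))")
    case True
    also have "norm g \<le> sqrt ((norm (1 + a * g))\<^sup>2 + (norm g)\<^sup>2)" by (rule real_sqrt_sum_squares_ge2)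
    finally show ?thesis .
  next
    case False
    have "norm (a * g) \<le> M * (1 / (2 * (M + 1)))"
      unfolding norm_mult using False assms M by (intro mult_mono) auto
    also have "\<dots> \<le> 1 / 2" using M by (simp add: field_simps)
    finally have "1 / 2 \<le> norm (1 + a * g)"
      using norm_triangle_ineq4[of "1 + a * g" "a * g"] by simp
    moreover have "1 / (2 * (M + 1)) \<le> 1 / 2" using M by (simp add: field_simps)
    moreover have "norm (1 + a * g) \<le> sqrt ((norm (1 + a * g))\<^sup>2 + (norm g)\<^sup>2)"
      by (rule real_sqrt_sum_squares_ge1)
    ultimately show ?thesis by linarith
  qed
qed

text \<open>For two points written with the same \<open>a\<close> the determinant collapses to h -
  g, and the norm bound gives the constant 2 (2 (M + 1))^2. Uniform convergence of coordinates thus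
  becomes chordal convergence.\<close>

lemma chordal_recip_coords_le:
  fixes a g h :: complex
  assumes "norm a \<le> M"
  shows "chordal (proj (1 + a * g) g) (proj (1 + a * h) h) \<le> 8 * (M + 1)\<^sup>2 * norm (g - h)"
proof -
  define N where "N = 1 / (2 * (M + 1))"
  have "M \<ge> 0" using assms norm_ge_zero order_trans by blast
  then have N: "N > 0" by (simp add: N_def)
  have nz: "1 + a * u \<noteq> 0 \<or> u \<noteq> 0" for u by (cases "u = 0") auto
  have "chordal (proj (1 + a * g) g) (proj (1 + a * h) h) = 2 * norm (g - h) /
    (sqrt ((norm (1 + a * g))\<^sup>2 + (norm g)\<^sup>2) * sqrt ((norm (1 + a * h))\<^sup>2 + (norm h)\<^sup>2))"
  proof -
    have "(1 + a * g) * h - (1 + a * h) * g = h - g" by (simp add: algebra_simps)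
    then show ?thesis by (simp add: chordal_proj[OF nz nz] norm_minus_commute)
  qed
  also have "\<dots> \<le> 2 * norm (g - h) / (N * N)"
    using N recip_coords_norm_ge[OF assms] unfolding N_def[symmetric]
    by (intro divide_left_mono mult_mono mult_pos_pos order.strict_trans2[OF N]) auto
  also have "\<dots> = 8 * (M + 1)\<^sup>2 * norm (g - h)"
    by (simp add: N_def power2_eq_square algebra_simps)
  finally show ?thesis .
qed

section \<open>Sequences that omit three functions near a point\<close>

text \<open>Convergence is uniform on all of \<open>U\<close>, which suits small discs, and
  \<open>g\<close> may be identically infinite.\<close>

definition sphere_limit ::
    "(nat \<Rightarrow> complex \<Rightarrow> complex option) \<Rightarrow> (complex \<Rightarrow> complex option) \<Rightarrow> complex set \<Rightarrow> bool" where
  "sphere_limit s g U \<longleftrightarrow> sphere_holo g U \<and>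
     (\<forall>e>0. \<forall>\<^sub>F n in sequentially. \<forall>z\<in>U. chordal (s n z) (g z) < e)"

text \<open>Montel's theorem applies to the coordinates 1 / (f - a), and
  \<open>chordal_recip_coords_le\<close> carries the convergence back to the sphere. Halving the
  radius puts a compact disc inside the ball.\<close>

lemma sphere_limit_if_recip_diff_bounded:
  assumes r: "r > 0" and hola: "a holomorphic_on ball z r" and M: "\<And>w. w \<in> ball z r \<Longrightarrow> norm (a w) \<le> M"
    and hol: "\<And>n. sphere_holo (s n) (ball z r)"
    and neq: "\<And>n w. w \<in> ball z r \<Longrightarrow> s n w \<noteq> Some (a w)"
    and C: "\<And>n w. w \<in> ball z r \<Longrightarrow> norm (recip_diff (s n w) (a w)) \<le> C"
  shows "\<exists>k g. strict_mono (k :: nat \<Rightarrow> nat) \<and> sphere_limit (s \<circ> k) g (ball z (r / 2))"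
proof -
  define G where "G n w = recip_diff (s n w) (a w)" for n w
  have holG: "G n holomorphic_on ball z r" for n
    unfolding G_def by (intro holomorphic_on_recip_diff hol hola neq) auto
  obtain g k where g: "g holomorphic_on ball z r" and k: "strict_mono (k :: nat \<Rightarrow> nat)"
    and unif: "\<And>K. compact K \<Longrightarrow> K \<subseteq> ball z r \<Longrightarrow> uniform_limit K (G \<circ> k) g sequentially"
  proof (rule Montel[of "ball z r" "range G" G])
    show "\<exists>B. \<forall>h\<in>range G. \<forall>w\<in>K. norm (h w) \<le> B" if "compact K" "K \<subseteq> ball z r" for K
      using that C by (intro exI[of _ C]) (auto simp: G_def)
  qed (use holG in auto)
  define f where "f w = proj (1 + a w * g w) (g w)" for w
  have s: "s n w = proj (1 + a w * G n w) (G n w)" if "w \<in> ball z r" for n w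
    unfolding G_def by (rule proj_recip_diff[OF neq[OF that]])
  have "norm (a z) \<le> M" using M r by simp
  then have M0: "M \<ge> 0" using norm_ge_zero[of "a z"] by linarith
  have f: "sphere_holo f (ball z r)"
    unfolding f_def
    by (rule sphere_holo_proj) (auto intro!: holomorphic_intros hola g)
  have "sphere_limit (s \<circ> k) f (ball z (r / 2))"
    unfolding sphere_limit_def
  proof (intro conjI allI impI)
    show "sphere_holo f (ball z (r / 2))"
      using r by (intro sphere_holo_subset[OF f] subset_ball) simp
    fix e :: real assume e: "e > 0"
    define d where "d = e / (8 * (M + 1)\<^sup>2)"
    have pos: "8 * (M + 1)\<^sup>2 > 0" using M0 by simp
    have d: "d > 0" using e pos by (simp add: d_def)
    have "uniform_limit (cball z (r / 2)) (G \<circ> k) g sequentially"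
      by (rule unif) (use r in auto)
    then have "\<forall>\<^sub>F n in sequentially. \<forall>w\<in>cball z (r / 2). dist ((G \<circ> k) n w) (g w) < d"
      using d by (rule uniform_limitD)
    then show "\<forall>\<^sub>F n in sequentially. \<forall>w\<in>ball z (r / 2). chordal ((s \<circ> k) n w) (f w) < e"
    proof eventually_elim
      case (elim n)
      show ?case
      proof
        fix w assume "w \<in> ball z (r / 2)"
        then have w: "w \<in> ball z r" "w \<in> cball z (r / 2)" using r by auto
        have "chordal ((s \<circ> k) n w) (f w) \<le> 8 * (M + 1)\<^sup>2 * norm (G (k n) w - g w)"
          unfolding comp_def s[OF w(1)] f_def by (rule chordal_recip_coords_le[OF M[OF w(1)]])
        also have "\<dots> < 8 * (M + 1)\<^sup>2 * d"
          using elim w(2) pos by (intro mult_strict_left_mono) (auto simp: dist_norm)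
        also have "\<dots> = e" using pos by (simp add: d_def)
        finally show "chordal ((s \<circ> k) n w) (f w) < e" .
      qed
    qed
  qed
  with k show ?thesis by blast
qed

lemma sphere_limit_subset:
  assumes "sphere_limit s g U" "V \<subseteq> U"
  shows "sphere_limit s g V"
  unfolding sphere_limit_def
proof (intro conjI allI impI)
  show "sphere_holo g V"
    using assms by (auto simp: sphere_limit_def intro: sphere_holo_subset)
  fix e :: real assume "e > 0"
  then have "\<forall>\<^sub>F n in sequentially. \<forall>z\<in>U. chordal (s n z) (g z) < e"
    using assms(1) by (simp add: sphere_limit_def)
  then show "\<forall>\<^sub>F n in sequentially. \<forall>z\<in>V. chordal (s n z) (g z) < e"
    by eventually_elim (use assms(2) in blast)
qed

lemma sphere_limit_subseq:
  assumes "sphere_limit s g U" "strict_mono (k :: nat \<Rightarrow> nat)"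
  shows "sphere_limit (s \<circ> k) g U"
  unfolding sphere_limit_def
proof (intro conjI allI impI)
  show "sphere_holo g U" using assms(1) by (simp add: sphere_limit_def)
  fix e :: real assume "e > 0"
  then have "\<forall>\<^sub>F n in sequentially. \<forall>z\<in>U. chordal (s n z) (g z) < e"
    using assms(1) by (simp add: sphere_limit_def)
  from eventually_subseq[OF assms(2) this]
  show "\<forall>\<^sub>F n in sequentially. \<forall>z\<in>U. chordal ((s \<circ> k) n z) (g z) < e"
    by (simp add: comp_def)
qed

text \<open>Schottky's theorem controls the cross ratio on a circle, and holomorphy of 1 / (f - a)
  and 1 / (f - b) on the full disc carries bounds across the centre, where \<open>a\<close>,
  \<open>b\<close>, \<open>c\<close> may coincide. The radius precedes the sequence, so one disc
  serves a whole family.\<close>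

lemma sphere_limit_if_omits:
  assumes R: "R > 0" and hola: "a holomorphic_on ball z R" and holb: "b holomorphic_on ball z R"
    and holc: "sphere_holo c (ball z R)"
    and ab: "\<And>w. w \<in> ball z R - {z} \<Longrightarrow> a w \<noteq> b w"
    and ca: "\<And>w. w \<in> ball z R - {z} \<Longrightarrow> c w \<noteq> Some (a w)"
    and cb: "\<And>w. w \<in> ball z R - {z} \<Longrightarrow> c w \<noteq> Some (b w)"
  shows "\<exists>\<rho>>0. \<forall>s. (\<forall>n. sphere_holo (s n) (ball z R) \<and>
      (\<forall>w\<in>ball z R. s n w \<noteq> Some (a w) \<and> s n w \<noteq> Some (b w)) \<and>
      (\<forall>w\<in>ball z R - {z}. s n w \<noteq> c w)) \<longrightarrow>
    (\<exists>k g. strict_mono (k :: nat \<Rightarrow> nat) \<and> sphere_limit (s \<circ> k) g (ball z \<rho>))"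
proof -
  define D where "D = ball z R - {z}"
  \<comment> \<open>Chosen so that \<rho> exp 20 = R / 2, as \<open>Schottky_circle\<close> asks for
    a value below \<open>R\<close>.\<close>
  define \<rho> where "\<rho> = R * exp (- 20) / 2"
  have \<rho>: "0 < \<rho>" "\<rho> * exp 20 < R"
    using R by (simp_all add: \<rho>_def exp_minus field_simps)
  have "\<rho> * 1 \<le> \<rho> * exp 20" using \<rho>(1) by (intro mult_left_mono) auto
  then have \<rho>R: "\<rho> < R" using \<rho>(2) by simp
  define C where "C = sphere z \<rho>"
  have C: "compact C" "C \<subseteq> D" using \<rho>(1) \<rho>R by (auto simp: C_def D_def)
  have D: "open D" "D \<subseteq> ball z R" by (auto simp: D_def)
  \<comment> \<open>\<open>\<beta>\<close> and \<open>\<gamma>\<close> are the positions of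
    \<open>b\<close> and \<open>c\<close> when \<open>a\<close> is at infinity. They are handled on
    the punctured disc, since \<open>a\<close> may meet \<open>b\<close> or \<open>c\<close> at the
    centre.\<close>
  define \<beta> where "\<beta> w = 1 / (b w - a w)" for w
  define \<gamma> where "\<gamma> w = recip_diff (c w) (a w)" for w
  have holaD: "a holomorphic_on D" and holbD: "b holomorphic_on D" and holcD: "sphere_holo c D"
    using hola holb holc D(2) holomorphic_on_subset sphere_holo_subset by blast+
  have hol\<beta>: "\<beta> holomorphic_on D"
    unfolding \<beta>_def by (intro holomorphic_intros holaD holbD) (use ab in \<open>force simp: D_def\<close>)
  have hol\<gamma>: "\<gamma> holomorphic_on D"
    unfolding \<gamma>_def by (intro holomorphic_on_recip_diff D holcD holaD) (use ca in \<open>simp add: D_def\<close>)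
  have \<beta>: "\<beta> w = recip_diff (Some (b w)) (a w)" for w
    by (simp add: \<beta>_def recip_diff_def inverse_eq_divide)
  have \<beta>\<gamma>: "\<beta> w - \<gamma> w \<noteq> 0" if "w \<in> D" for w
    using recip_diff_inject[of "Some (b w)" "a w" "c w"] that ab[of w] ca[of w] cb[of w]
    unfolding \<beta> \<gamma>_def by (auto simp: D_def)
  have hol1: "(\<lambda>w. \<beta> w - \<gamma> w) holomorphic_on D" and hol2: "(\<lambda>w. 1 / (\<beta> w - \<gamma> w)) holomorphic_on D"
    by (intro holomorphic_intros hol\<beta> hol\<gamma> \<beta>\<gamma>; assumption)+
  obtain M1 where M1: "M1 > 0" "\<forall>w\<in>C. norm (\<beta> w - \<gamma> w) \<le> M1"
    using holomorphic_on_compact_norm_le[OF hol1 C] by blast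
  obtain M2 where M2: "M2 > 0" "\<forall>w\<in>C. norm (\<gamma> w) \<le> M2"
    using holomorphic_on_compact_norm_le[OF hol\<gamma> C] by blast
  obtain M3 where M3: "M3 > 0" "\<forall>w\<in>C. norm (\<beta> w) \<le> M3"
    using holomorphic_on_compact_norm_le[OF hol\<beta> C] by blast
  obtain M4 where M4: "M4 > 0" "\<forall>w\<in>C. norm (1 / (\<beta> w - \<gamma> w)) \<le> M4"
    using holomorphic_on_compact_norm_le[OF hol2 C] by blast
  have cball: "compact (cball z \<rho>)" "cball z \<rho> \<subseteq> ball z R" using \<rho>R by auto
  obtain Ma where Ma: "\<forall>w\<in>cball z \<rho>. norm (a w) \<le> Ma"
    using holomorphic_on_compact_norm_le[OF hola cball] by blast
  obtain Mb where Mb: "\<forall>w\<in>cball z \<rho>. norm (b w) \<le> Mb"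
    using holomorphic_on_compact_norm_le[OF holb cball] by blast
  \<comment> \<open>If \<open>a z = b z\<close>, the lower bound is vacuous and 1 is a placeholder;
    the unbounded case below refutes this equality before it uses \<epsilon>.\<close>
  obtain \<sigma> \<epsilon> where \<sigma>: "0 < \<sigma>" "\<sigma> \<le> \<rho>" and \<epsilon>: "\<epsilon> > 0"
    "\<And>w. a z \<noteq> b z \<Longrightarrow> w \<in> ball z \<sigma> \<Longrightarrow> \<epsilon> \<le> norm (b w - a w)"
  proof (cases "a z = b z")
    case True
    show thesis by (rule that[of \<rho> 1]) (use True \<rho> in auto)
  next
    case False
    define \<epsilon> where "\<epsilon> = norm (b z - a z) / 2"
    have "(\<lambda>w. b w - a w) holomorphic_on ball z R" by (intro holomorphic_intros hola holb)
    then have "isCont (\<lambda>w. b w - a w) z"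
      using R by (metis centre_in_ball continuous_on_eq_continuous_at holomorphic_on_imp_continuous_on open_ball)
    moreover have "\<epsilon> > 0" using False by (simp add: \<epsilon>_def)
    ultimately obtain d where d: "d > 0" "\<And>w. dist w z < d \<Longrightarrow> dist (b w - a w) (b z - a z) < \<epsilon>"
      unfolding continuous_at_eps_delta by metis
    show thesis
    proof (rule that[of "min d \<rho>" \<epsilon>])
      fix w assume "w \<in> ball z (min d \<rho>)"
      then have "norm ((b w - a w) - (b z - a z)) < \<epsilon>" using d(2)[of w] by (simp add: dist_norm norm_minus_commute)
      then show "\<epsilon> \<le> norm (b w - a w)"
        using norm_triangle_ineq2[of "b z - a z" "b w - a w"]
        by (simp add: \<epsilon>_def norm_minus_commute)
    qed (use d \<rho> \<open>\<epsilon> > 0\<close> in auto)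
  qed
  have \<sigma>R: "ball z \<sigma> \<subseteq> ball z R" and \<sigma>\<rho>: "ball z \<sigma> \<subseteq> cball z \<rho>" using \<sigma>(2) \<rho>R by auto
  have main: "\<exists>k g. strict_mono (k :: nat \<Rightarrow> nat) \<and> sphere_limit (s \<circ> k) g (ball z (\<sigma> / 2))"
    if hols: "\<And>n. sphere_holo (s n) (ball z R)"
      and sa: "\<And>n w. w \<in> ball z R \<Longrightarrow> s n w \<noteq> Some (a w)"
      and sb: "\<And>n w. w \<in> ball z R \<Longrightarrow> s n w \<noteq> Some (b w)"
      and sc: "\<And>n w. w \<in> D \<Longrightarrow> s n w \<noteq> c w"
    for s
  proof -
    define G where "G n w = recip_diff (s n w) (a w)" for n w
    define G' where "G' n w = recip_diff (s n w) (b w)" for n w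
    \<comment> \<open>The cross ratio: with \<open>a\<close> already at infinity, an affine change
      moves \<open>\<gamma>\<close> to 0 and \<open>\<beta>\<close> to 1, so omitting
      \<open>c\<close> and \<open>b\<close> means omitting 0 and 1.\<close>
    define H where "H n w = (G n w - \<gamma> w) / (\<beta> w - \<gamma> w)" for n w
    have holG: "G n holomorphic_on ball z R" for n
      unfolding G_def by (intro holomorphic_on_recip_diff hols hola sa) auto
    have holG': "G' n holomorphic_on ball z R" for n
      unfolding G'_def by (intro holomorphic_on_recip_diff hols holb sb) auto
    have holH: "H n holomorphic_on D" for n
      unfolding H_def by (intro holomorphic_intros hol\<beta> hol\<gamma> \<beta>\<gamma> holG[THEN holomorphic_on_subset] D)
    have H01: "H n w \<noteq> 0 \<and> H n w \<noteq> 1" if "w \<in> D" for n w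
    proof -
      have w: "w \<in> ball z R" using that by (simp add: D_def)
      have "G n w \<noteq> \<gamma> w"
        unfolding G_def \<gamma>_def using recip_diff_inject[OF sa[OF w] ca] sc that by (auto simp: D_def)
      moreover have "G n w \<noteq> \<beta> w"
        unfolding G_def \<beta> using recip_diff_inject[OF sa[OF w], of "Some (b w)"] sb[OF w] ab[of w] that
        by (auto simp: D_def)
      ultimately show ?thesis using \<beta>\<gamma>[OF that] by (simp add: H_def)
    qed
    show ?thesis
    \<comment> \<open>Either infinitely many \<open>H n\<close> are bounded by a common
      \<open>L\<close> somewhere on the circle, or for each \<open>L\<close> all but finitely many
      exceed it on the whole circle.\<close>
    proof (cases "\<exists>L. infinite {n. \<exists>w\<in>C. norm (H n w) \<le> L}")
      case True
      then obtain L where "infinite {n. \<exists>w\<in>C. norm (H n w) \<le> L}" by blast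
      from infinite_enumerate[OF this] obtain k :: "nat \<Rightarrow> nat"
        where k: "strict_mono k" "\<forall>n. k n \<in> {n. \<exists>w\<in>C. norm (H n w) \<le> L}" by blast
      define B where "B = exp (pi * exp (pi * (14 + 2 * L)))"
      have HB: "norm (H (k n) w) \<le> B" if "w \<in> C" for n w
      proof -
        obtain v where "v \<in> C" "norm (H (k n) v) \<le> L" using k(2)[rule_format, of n] by blast
        then show ?thesis
          unfolding B_def using that
          by (intro Schottky_circle[OF holH[unfolded D_def] H01[unfolded D_def] \<rho>]) (auto simp: C_def)
      qed
      have "norm (G (k n) w) \<le> B * M1 + M2" if "w \<in> C" for n w
      proof -
        have "G (k n) w = H (k n) w * (\<beta> w - \<gamma> w) + \<gamma> w"
          using \<beta>\<gamma> that C(2) by (auto simp: H_def)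
        also have "norm \<dots> \<le> norm (H (k n) w) * norm (\<beta> w - \<gamma> w) + norm (\<gamma> w)"
          by (metis norm_mult norm_triangle_ineq)
        also have "\<dots> \<le> B * M1 + M2"
          using HB that M1 M2
          by (intro add_mono mult_mono) (auto simp: B_def)
        finally show ?thesis .
      qed
      \<comment> \<open>\<open>H n\<close> may be singular at \<open>z\<close>, but
        \<open>G n\<close> is holomorphic on the full disc, so the maximum principle extends its
        bound inward.\<close>
      then have bnd: "norm (G (k n) w) \<le> B * M1 + M2" if "w \<in> cball z \<rho>" for n w
        using norm_le_on_cball_if_on_sphere[OF holG \<rho>(1) \<rho>R _ that, of "k n" "B * M1 + M2"]
        by (simp add: C_def)
      have "\<exists>l g. strict_mono (l :: nat \<Rightarrow> nat) \<and> sphere_limit ((\<lambda>n. s (k n)) \<circ> l) g (ball z (\<sigma> / 2))"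
      proof (rule sphere_limit_if_recip_diff_bounded[OF \<sigma>(1)])
        show "a holomorphic_on ball z \<sigma>" using hola \<sigma>R by (rule holomorphic_on_subset)
        show "sphere_holo (s (k n)) (ball z \<sigma>)" for n using hols \<sigma>R by (rule sphere_holo_subset)
        show "norm (a w) \<le> Ma" if "w \<in> ball z \<sigma>" for w using Ma \<sigma>\<rho> that by blast
        show "s (k n) w \<noteq> Some (a w)" if "w \<in> ball z \<sigma>" for n w using sa \<sigma>R that by blast
        show "norm (recip_diff (s (k n) w) (a w)) \<le> B * M1 + M2" if "w \<in> ball z \<sigma>" for n w
          using bnd[unfolded G_def] \<sigma>\<rho> that by blast
      qed
      then obtain l g where lg: "strict_mono (l :: nat \<Rightarrow> nat)" "sphere_limit ((\<lambda>n. s (k n)) \<circ> l) g (ball z (\<sigma> / 2))"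
        by blast
      have "(\<lambda>n. s (k n)) \<circ> l = s \<circ> (k \<circ> l)" by (simp add: comp_def)
      then show ?thesis
        using lg(2) strict_mono_o[OF k(1) lg(1)] by (intro exI[of _ "k \<circ> l"] exI[of _ g]) simp
    next
      case False
      \<comment> \<open>As |H| \<le> (|G| + M2) M4 on the circle, exceeding \<open>L\<close> forces
        |G| > 3 M3. There |b - a| \<ge> 1 / M3, so |(b - a) G| \<ge> 3, which yields |u| \<le>
        1/2.\<close>
      define L where "L = (3 * M3 + M2) * M4"
      have "finite {n. \<exists>w\<in>C. norm (H n w) \<le> L}" using False by blast
      then have "\<forall>\<^sub>F n in sequentially. \<not> (\<exists>w\<in>C. norm (H n w) \<le> L)"
        by (simp add: eventually_cofinite flip: cofinite_eq_sequentially)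
      then obtain N where "\<forall>n\<ge>N. \<not> (\<exists>w\<in>C. norm (H n w) \<le> L)"
        unfolding eventually_sequentially by blast
      then have N: "norm (H n w) > L" if "n \<ge> N" "w \<in> C" for n w
        using that not_le by blast
      \<comment> \<open>\<open>u n\<close> is \<open>(s n - a) / (s n - b)\<close>, but without a singularity at the poles of \<open>s n\<close>.\<close>
      define u where "u n w = 1 + (b w - a w) * G' n w" for n w
      have holu: "u n holomorphic_on ball z R" for n
        unfolding u_def by (intro holomorphic_intros hola holb holG')
      \<comment> \<open>The second factor is (s - b) / (s - a), the reciprocal of
        \<open>u n\<close>; at poles of \<open>s n\<close> both factors are 1.\<close>
      have uG: "u n w * (1 - (b w - a w) * G n w) = 1" if "w \<in> ball z R" for n w
      proof (cases "s n w")
        case None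
        then show ?thesis by (simp add: u_def G_def G'_def recip_diff_def)
      next
        case (Some x)
        then have x: "x - a w \<noteq> 0" "x - b w \<noteq> 0" using sa[OF that, of n] sb[OF that, of n] by auto
        have "u n w = (x - a w) / (x - b w)" "1 - (b w - a w) * G n w = (x - b w) / (x - a w)"
          using x by (simp_all add: Some u_def G_def G'_def recip_diff_def divide_simps)
        then show ?thesis using x by simp
      qed
      have "norm (u n w) \<le> 1 / 2" if "n \<ge> N" "w \<in> C" for n w
      proof -
        have wD: "w \<in> D" "w \<in> ball z R" using that(2) C(2) D(2) by auto
        have "H n w = (G n w - \<gamma> w) * (1 / (\<beta> w - \<gamma> w))" by (simp add: H_def)
        then have "norm (H n w) \<le> norm (G n w - \<gamma> w) * M4"
          using M4(2)[rule_format, OF that(2)] by (metis mult_left_mono norm_ge_zero norm_mult)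
        with N[OF that] have "(3 * M3 + M2) * M4 < norm (G n w - \<gamma> w) * M4" by (simp add: L_def)
        then have "3 * M3 + M2 < norm (G n w - \<gamma> w)" using M4(1) by simp
        also have "\<dots> \<le> norm (G n w) + M2" using norm_triangle_ineq4[of "G n w" "\<gamma> w"] M2(2)[rule_format, OF that(2)] by simp
        finally have G: "3 * M3 < norm (G n w)" by simp
        have "3 * (norm (b w - a w) * norm (\<beta> w)) = 3"
          using ab[of w] wD(1) by (simp add: \<beta>_def norm_divide D_def)
        then have "3 \<le> norm (b w - a w) * (3 * M3)"
          using mult_left_mono[OF M3(2)[rule_format, OF that(2)], of "norm (b w - a w)"] by simp
        also have "\<dots> \<le> norm (b w - a w) * norm (G n w)"
          using G by (intro mult_left_mono) auto
        finally have "3 \<le> norm ((b w - a w) * G n w)" by (simp add: norm_mult)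
        then have 2: "2 \<le> norm (1 - (b w - a w) * G n w)"
          using norm_triangle_ineq3[of 1 "(b w - a w) * G n w"] by simp
        have "norm (u n w) * 2 \<le> norm (u n w) * norm (1 - (b w - a w) * G n w)"
          using 2 by (intro mult_left_mono) auto
        also have "\<dots> = 1" using uG[OF wD(2), of n] by (metis norm_mult norm_one)
        finally show ?thesis by simp
      qed
      then have u: "norm (u n w) \<le> 1 / 2" if "n \<ge> N" "w \<in> cball z \<rho>" for n w
        using norm_le_on_cball_if_on_sphere[OF holu \<rho>(1) \<rho>R _ that(2), of n "1 / 2"] that(1)
        by (simp add: C_def)
      have neq: "a z \<noteq> b z"
      proof
        assume "a z = b z"
        then have "u N z = 1" by (simp add: u_def)
        then show False using u[of N z] \<rho>(1) by simp
      qed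
      \<comment> \<open>This rests on (b - a) G' = u - 1, whose right side has modulus at most
        2.\<close>
      have bnd: "norm (G' n w) \<le> 2 / \<epsilon>" if "n \<ge> N" "w \<in> ball z \<sigma>" for n w
      proof -
        have "\<epsilon> * norm (G' n w) \<le> norm (b w - a w) * norm (G' n w)"
          using \<epsilon>(2)[OF neq that(2)] by (intro mult_right_mono) auto
        also have "\<dots> = norm (u n w - 1)" by (simp add: u_def norm_mult)
        also have "\<dots> \<le> 2" using norm_triangle_ineq4[of "u n w" 1] u[OF that(1)] \<sigma>\<rho> that(2) by force
        finally show ?thesis using \<epsilon>(1) by (simp add: field_simps)
      qed
      \<comment> \<open>Dropping the first \<open>N\<close> terms makes the bound hold for every
        index; the shift is absorbed into the subsequence afterwards.\<close>
      have "\<exists>l g. strict_mono (l :: nat \<Rightarrow> nat) \<and> sphere_limit ((\<lambda>n. s (n + N)) \<circ> l) g (ball z (\<sigma> / 2))"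
      proof (rule sphere_limit_if_recip_diff_bounded[OF \<sigma>(1)])
        show "b holomorphic_on ball z \<sigma>" using holb \<sigma>R by (rule holomorphic_on_subset)
        show "sphere_holo (s (n + N)) (ball z \<sigma>)" for n using hols \<sigma>R by (rule sphere_holo_subset)
        show "norm (b w) \<le> Mb" if "w \<in> ball z \<sigma>" for w using Mb \<sigma>\<rho> that by blast
        show "s (n + N) w \<noteq> Some (b w)" if "w \<in> ball z \<sigma>" for n w using sb \<sigma>R that by blast
        show "norm (recip_diff (s (n + N) w) (b w)) \<le> 2 / \<epsilon>" if "w \<in> ball z \<sigma>" for n w
          using bnd[of "n + N" w] that by (simp add: G'_def)
      qed
      then obtain l g where lg: "strict_mono (l :: nat \<Rightarrow> nat)" "sphere_limit ((\<lambda>n. s (n + N)) \<circ> l) g (ball z (\<sigma> / 2))"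
        by blast
      have "(\<lambda>n. s (n + N)) \<circ> l = s \<circ> (\<lambda>n. l n + N)" by (simp add: comp_def)
      moreover have "strict_mono (\<lambda>n. l n + N)" using lg(1) by (simp add: strict_mono_def)
      ultimately show ?thesis using lg(2) by (intro exI[of _ "\<lambda>n. l n + N"] exI[of _ g]) simp
    qed
  qed
  show ?thesis
  proof (intro exI[of _ "\<sigma> / 2"] conjI allI impI)
    fix s :: "nat \<Rightarrow> complex \<Rightarrow> complex option"
    assume s: "\<forall>n. sphere_holo (s n) (ball z R) \<and>
      (\<forall>w\<in>ball z R. s n w \<noteq> Some (a w) \<and> s n w \<noteq> Some (b w)) \<and>
      (\<forall>w\<in>ball z R - {z}. s n w \<noteq> c w)"
    show "\<exists>k g. strict_mono (k :: nat \<Rightarrow> nat) \<and> sphere_limit (s \<circ> k) g (ball z (\<sigma> / 2))"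
      by (rule main) (use s in \<open>simp_all add: D_def\<close>)
  qed (use \<sigma>(1) in simp)
qed

lemma sphere_holo_finite_near:
  assumes "sphere_holo f S" "open S" "z \<in> S" "f z \<noteq> None"
  shows "\<exists>r>0. \<exists>a. a holomorphic_on ball z r \<and> (\<forall>w\<in>ball z r. f w = Some (a w))"
proof -
  obtain r p q where f: "r > 0" "p holomorphic_on ball z r" "q holomorphic_on ball z r"
    "\<And>w. w \<in> ball z r \<Longrightarrow> f w = proj (p w) (q w)"
    using sphere_holoE[OF assms(1-3)] by metis
  have B: "z \<in> ball z r" using f(1) by simp
  have qz: "q z \<noteq> 0"
    using f(4)[OF B] assms(4) by (auto simp: proj_def)
  have "isCont q z"
    using f(3) B by (meson continuous_on_eq_continuous_at holomorphic_on_imp_continuous_on open_ball)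
  then obtain e where e: "e > 0" "\<forall>w. dist z w < e \<longrightarrow> q w \<noteq> 0"
    using qz continuous_at_avoid by blast
  show ?thesis
  proof (intro exI[of _ "min r e"] exI[of _ "\<lambda>w. p w / q w"] conjI ballI)
    show "(\<lambda>w. p w / q w) holomorphic_on ball z (min r e)"
      by (intro holomorphic_intros f(2,3)[THEN holomorphic_on_subset]) (use e in auto)
    show "f w = Some (p w / q w)" if "w \<in> ball z (min r e)" for w
      using f(4)[of w] e(2) that by (auto simp: proj_def)
  qed (use f(1) e(1) in simp)
qed

text \<open>Rotations preserve the chordal distance, so applying the inverse rotation to the limit
  undoes them.\<close>

lemma sphere_limit_rot:
  assumes "sphere_limit (\<lambda>n w. rot t (s n w)) g U"
  shows "sphere_limit s (\<lambda>w. rot (- t) (g w)) U"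
proof -
  have "chordal (s n w) (rot (- t) (g w)) = chordal (rot t (s n w)) (g w)" for n w
    using chordal_rot[of t "s n w" "rot (- t) (g w)"] rot_minus_rot[of "- t" "g w"] by simp
  then show ?thesis
    using assms sphere_holo_rot by (simp add: sphere_limit_def)
qed

text \<open>A rotation makes \<open>x\<close> and \<open>y\<close> finite at \<open>z\<close>, hence
  holomorphic functions on a smaller disc. It is fixed by \<open>x z\<close> and \<open>y z\<close>,
  so one rotation and one radius serve all sequences.\<close>

lemma sphere_limit_if_omits_two:
  assumes R: "R > 0" and x: "sphere_holo x (ball z R)" and y: "sphere_holo y (ball z R)"
    and c: "sphere_holo c (ball z R)"
    and distinct: "\<forall>w\<in>ball z R - {z}. x w \<noteq> y w \<and> c w \<noteq> x w \<and> c w \<noteq> y w"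
  shows "\<exists>\<rho>>0. \<forall>s. (\<forall>n. sphere_holo (s n) (ball z R) \<and>
      (\<forall>w\<in>ball z R. s n w \<noteq> x w \<and> s n w \<noteq> y w) \<and> (\<forall>w\<in>ball z R - {z}. s n w \<noteq> c w)) \<longrightarrow>
    (\<exists>k g. strict_mono (k :: nat \<Rightarrow> nat) \<and> sphere_limit (s \<circ> k) g (ball z \<rho>))"
proof -
  have z: "z \<in> ball z R" using R by simp
  obtain t where t: "rot t (x z) \<noteq> None" "rot t (y z) \<noteq> None" using rot_finite_exists by blast
  obtain r1 a where a: "r1 > 0" "a holomorphic_on ball z r1" "\<forall>w\<in>ball z r1. rot t (x w) = Some (a w)"
    using sphere_holo_finite_near[OF sphere_holo_rot[OF x] open_ball z t(1)] by blast
  obtain r2 b where b: "r2 > 0" "b holomorphic_on ball z r2" "\<forall>w\<in>ball z r2. rot t (y w) = Some (b w)"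
    using sphere_holo_finite_near[OF sphere_holo_rot[OF y] open_ball z t(2)] by blast
  define r where "r = min R (min r1 r2)"
  have r: "r > 0" "ball z r \<subseteq> ball z R" "ball z r \<subseteq> ball z r1" "ball z r \<subseteq> ball z r2"
    using R a(1) b(1) by (auto simp: r_def)
  have eqa: "Some (a w) = rot t (x w)" and eqb: "Some (b w) = rot t (y w)" if "w \<in> ball z r" for w
    using a(3) b(3) r that by auto
  have dist: "x w \<noteq> y w" "c w \<noteq> x w" "c w \<noteq> y w" if "w \<in> ball z r - {z}" for w
    using distinct r(2) that by blast+
  have "\<exists>\<rho>>0. \<forall>s. (\<forall>n. sphere_holo (s n) (ball z r) \<and>
      (\<forall>w\<in>ball z r. s n w \<noteq> Some (a w) \<and> s n w \<noteq> Some (b w)) \<and>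
      (\<forall>w\<in>ball z r - {z}. s n w \<noteq> rot t (c w))) \<longrightarrow>
    (\<exists>k g. strict_mono (k :: nat \<Rightarrow> nat) \<and> sphere_limit (s \<circ> k) g (ball z \<rho>))"
  proof (rule sphere_limit_if_omits[OF r(1)])
    show "a holomorphic_on ball z r" "b holomorphic_on ball z r"
      using a(2) b(2) r by (auto intro: holomorphic_on_subset)
    show "sphere_holo (\<lambda>w. rot t (c w)) (ball z r)"
      using sphere_holo_subset[OF c r(2)] by (rule sphere_holo_rot)
    fix w assume w: "w \<in> ball z r - {z}"
    then have w': "w \<in> ball z r" by simp
    show "rot t (c w) \<noteq> Some (a w)" "rot t (c w) \<noteq> Some (b w)"
      unfolding eqa[OF w'] eqb[OF w'] rot_eq_iff using dist[OF w] by blast+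
    have "Some (a w) \<noteq> Some (b w)"
      unfolding eqa[OF w'] eqb[OF w'] rot_eq_iff using dist[OF w] by blast
    then show "a w \<noteq> b w" by simp
  qed
  then obtain \<rho> where \<rho>: "\<rho> > 0" and main: "\<And>s. (\<forall>n. sphere_holo (s n) (ball z r) \<and>
      (\<forall>w\<in>ball z r. s n w \<noteq> Some (a w) \<and> s n w \<noteq> Some (b w)) \<and>
      (\<forall>w\<in>ball z r - {z}. s n w \<noteq> rot t (c w))) \<Longrightarrow>
    \<exists>k g. strict_mono (k :: nat \<Rightarrow> nat) \<and> sphere_limit (s \<circ> k) g (ball z \<rho>)"
    by blast
  show ?thesis
  proof (intro exI[of _ \<rho>] conjI allI impI \<rho>)
    fix s :: "nat \<Rightarrow> complex \<Rightarrow> complex option"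
    assume s: "\<forall>n. sphere_holo (s n) (ball z R) \<and>
      (\<forall>w\<in>ball z R. s n w \<noteq> x w \<and> s n w \<noteq> y w) \<and> (\<forall>w\<in>ball z R - {z}. s n w \<noteq> c w)"
    have "\<exists>k g. strict_mono (k :: nat \<Rightarrow> nat) \<and> sphere_limit ((\<lambda>n w. rot t (s n w)) \<circ> k) g (ball z \<rho>)"
    proof (rule main, intro allI conjI ballI)
      fix n
      show "sphere_holo (\<lambda>w. rot t (s n w)) (ball z r)"
        using s sphere_holo_subset[OF _ r(2)] sphere_holo_rot by blast
      fix w assume w: "w \<in> ball z r"
      then have w': "w \<in> ball z R" using r(2) by blast
      show "rot t (s n w) \<noteq> Some (a w)" "rot t (s n w) \<noteq> Some (b w)"
        unfolding eqa[OF w] eqb[OF w] rot_eq_iff using s w' by blast+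
    next
      fix n w assume "w \<in> ball z r - {z}"
      then show "rot t (s n w) \<noteq> rot t (c w)"
        unfolding rot_eq_iff using s r(2) by blast
    qed
    then obtain k g where k: "strict_mono (k :: nat \<Rightarrow> nat)"
      and "sphere_limit ((\<lambda>n w. rot t (s n w)) \<circ> k) g (ball z \<rho>)"
      by blast
    then have "sphere_limit (\<lambda>n w. rot t ((s \<circ> k) n w)) g (ball z \<rho>)" by (simp add: comp_def)
    from sphere_limit_rot[OF this] k
    show "\<exists>k g. strict_mono (k :: nat \<Rightarrow> nat) \<and> sphere_limit (s \<circ> k) g (ball z \<rho>)" by blast
  qed
qed

section \<open>Normality of the family near a point\<close>

definition seq_normal_on :: "(complex \<Rightarrow> complex option) set \<Rightarrow> complex set \<Rightarrow> bool" where
  "seq_normal_on F U \<longleftrightarrow> (\<forall>s. (\<forall>n. s n \<in> F) \<longrightarrow>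
     (\<exists>k g. strict_mono (k :: nat \<Rightarrow> nat) \<and> sphere_limit (s \<circ> k) g U))"

lemma seq_normal_on_subset: "seq_normal_on F U \<Longrightarrow> V \<subseteq> U \<Longrightarrow> seq_normal_on F V"
  unfolding seq_normal_on_def using sphere_limit_subset by meson

lemma infinite_subseq:
  assumes "infinite {n. P (s n)}"
  shows "\<exists>k :: nat \<Rightarrow> nat. strict_mono k \<and> (\<forall>n. P ((s \<circ> k) n))"
  using infinite_enumerate[OF assms] by auto

text \<open>One of the two families contains infinitely many terms of the sequence; a limit is
  extracted from those.\<close>

lemma seq_normal_on_Un:
  assumes "seq_normal_on F U" "seq_normal_on G U"
  shows "seq_normal_on (F \<union> G) U"
  unfolding seq_normal_on_def
proof (intro allI impI)
  fix s :: "nat \<Rightarrow> complex \<Rightarrow> complex option"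
  assume "\<forall>n. s n \<in> F \<union> G"
  then have "UNIV = {n. s n \<in> F} \<union> {n. s n \<in> G}" by auto
  then have "infinite {n. s n \<in> F} \<or> infinite {n. s n \<in> G}"
    by (metis finite_Un infinite_UNIV_nat)
  then obtain H k where H: "seq_normal_on H U" "strict_mono (k :: nat \<Rightarrow> nat)" "\<forall>n. (s \<circ> k) n \<in> H"
    using infinite_subseq[of "\<lambda>f. f \<in> F" s] infinite_subseq[of "\<lambda>f. f \<in> G" s] assms by blast
  from H(1)[unfolded seq_normal_on_def, THEN spec, THEN mp, OF H(3)]
  obtain l g where "strict_mono (l :: nat \<Rightarrow> nat)" "sphere_limit (s \<circ> k \<circ> l) g U" by blast
  then show "\<exists>k g. strict_mono (k :: nat \<Rightarrow> nat) \<and> sphere_limit (s \<circ> k) g U"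
    using strict_mono_o[OF H(2)] by (intro exI[of _ "k \<circ> l"] exI[of _ g]) (simp add: o_assoc)
qed

text \<open>By \<open>centre\<close>, a member equal to one of the three functions at
  \<open>z\<close> differs from the other two there. Hence the family is a union of three
  subfamilies, each avoiding a fixed pair at \<open>z\<close>.\<close>

lemma seq_normal_near:
  assumes \<Omega>: "open \<Omega>" "z \<in> \<Omega>"
    and F: "\<forall>f\<in>F. sphere_holo f \<Omega>"
    and \<psi>: "sphere_holo \<psi>1 \<Omega>" "sphere_holo \<psi>2 \<Omega>" "sphere_holo \<psi>3 \<Omega>"
    and distinct: "\<forall>\<^sub>F w in at z. \<psi>1 w \<noteq> \<psi>2 w \<and> \<psi>1 w \<noteq> \<psi>3 w \<and> \<psi>2 w \<noteq> \<psi>3 w"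
    and omit: "\<forall>\<^sub>F w in at z. \<forall>f\<in>F. f w \<notin> {\<psi>1 w, \<psi>2 w, \<psi>3 w}"
    and centre: "\<forall>f\<in>F. (\<psi>1 z = \<psi>2 z \<longrightarrow> f z \<noteq> \<psi>1 z) \<and> (\<psi>1 z = \<psi>3 z \<longrightarrow> f z \<noteq> \<psi>1 z) \<and>
      (\<psi>2 z = \<psi>3 z \<longrightarrow> f z \<noteq> \<psi>2 z)"
  shows "\<exists>\<rho>>0. seq_normal_on F (ball z \<rho>)"
proof -
  have "\<forall>\<^sub>F w in at z. (\<psi>1 w \<noteq> \<psi>2 w \<and> \<psi>1 w \<noteq> \<psi>3 w \<and> \<psi>2 w \<noteq> \<psi>3 w) \<and> (\<forall>f\<in>F. f w \<notin> {\<psi>1 w, \<psi>2 w, \<psi>3 w})"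
    using distinct omit by (rule eventually_conj)
  from eventually_at_openD[OF this] obtain T where T: "open T" "z \<in> T"
    "\<forall>w\<in>T. w \<noteq> z \<longrightarrow> (\<psi>1 w \<noteq> \<psi>2 w \<and> \<psi>1 w \<noteq> \<psi>3 w \<and> \<psi>2 w \<noteq> \<psi>3 w) \<and> (\<forall>f\<in>F. f w \<notin> {\<psi>1 w, \<psi>2 w, \<psi>3 w})"
    by blast
  have "open (T \<inter> \<Omega>)" "z \<in> T \<inter> \<Omega>" using T \<Omega> by auto
  then obtain R where R: "R > 0" "ball z R \<subseteq> T \<inter> \<Omega>" by (meson open_contains_ball_eq)
  have dist: "\<psi>1 w \<noteq> \<psi>2 w" "\<psi>1 w \<noteq> \<psi>3 w" "\<psi>2 w \<noteq> \<psi>3 w" if "w \<in> ball z R - {z}" for w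
    using T(3) R(2) that by blast+
  have om: "f w \<noteq> \<psi>1 w" "f w \<noteq> \<psi>2 w" "f w \<noteq> \<psi>3 w" if "w \<in> ball z R - {z}" "f \<in> F" for f w
    using T(3) R(2) that by blast+
  have sub: "ball z R \<subseteq> \<Omega>" using R(2) by blast
  note holo = \<psi>[THEN sphere_holo_subset, OF sub]
  have holF: "sphere_holo f (ball z R)" if "f \<in> F" for f
    using F sphere_holo_subset[OF _ sub] that by blast
  \<comment> \<open>\<open>x\<close> and \<open>y\<close> are the functions avoided at the centre
    too; \<open>c\<close> is the third one, known to be avoided off the centre.\<close>
  have pair: "\<exists>\<rho>>0. seq_normal_on {f \<in> F. f z \<noteq> x z \<and> f z \<noteq> y z} (ball z \<rho>)"
    if xyc: "sphere_holo x (ball z R)" "sphere_holo y (ball z R)" "sphere_holo c (ball z R)"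
      and "\<And>w. w \<in> ball z R - {z} \<Longrightarrow> x w \<noteq> y w" "\<And>w. w \<in> ball z R - {z} \<Longrightarrow> c w \<noteq> x w"
        "\<And>w. w \<in> ball z R - {z} \<Longrightarrow> c w \<noteq> y w"
      and omx: "\<And>f w. w \<in> ball z R - {z} \<Longrightarrow> f \<in> F \<Longrightarrow> f w \<noteq> x w"
      and omy: "\<And>f w. w \<in> ball z R - {z} \<Longrightarrow> f \<in> F \<Longrightarrow> f w \<noteq> y w"
      and omc: "\<And>f w. w \<in> ball z R - {z} \<Longrightarrow> f \<in> F \<Longrightarrow> f w \<noteq> c w"
    for x y c
  proof -
    have "\<forall>w\<in>ball z R - {z}. x w \<noteq> y w \<and> c w \<noteq> x w \<and> c w \<noteq> y w" using that(4-6) by blast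
    from sphere_limit_if_omits_two[OF R(1) xyc this]
    obtain \<rho> where \<rho>: "\<rho> > 0" and main: "\<forall>s. (\<forall>n. sphere_holo (s n) (ball z R) \<and>
      (\<forall>w\<in>ball z R. s n w \<noteq> x w \<and> s n w \<noteq> y w) \<and> (\<forall>w\<in>ball z R - {z}. s n w \<noteq> c w)) \<longrightarrow>
      (\<exists>k g. strict_mono (k :: nat \<Rightarrow> nat) \<and> sphere_limit (s \<circ> k) g (ball z \<rho>))"
      by blast
    have "seq_normal_on {f \<in> F. f z \<noteq> x z \<and> f z \<noteq> y z} (ball z \<rho>)"
      unfolding seq_normal_on_def
    proof (intro allI impI)
      fix s :: "nat \<Rightarrow> complex \<Rightarrow> complex option"
      assume s: "\<forall>n. s n \<in> {f \<in> F. f z \<noteq> x z \<and> f z \<noteq> y z}"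
      show "\<exists>k g. strict_mono (k :: nat \<Rightarrow> nat) \<and> sphere_limit (s \<circ> k) g (ball z \<rho>)"
      proof (rule main[rule_format], intro conjI ballI)
        fix n
        have n: "s n \<in> F" "s n z \<noteq> x z" "s n z \<noteq> y z" using s by auto
        show "sphere_holo (s n) (ball z R)" using holF[OF n(1)] .
        show "s n w \<noteq> x w" "s n w \<noteq> y w" if "w \<in> ball z R" for w
          using omx[OF _ n(1), of w] omy[OF _ n(1), of w] n(2,3) that by (cases "w = z"; auto)+
        show "s n w \<noteq> c w" if "w \<in> ball z R - {z}" for w using omc[OF that n(1)] .
      qed
    qed
    with \<rho> show ?thesis by blast
  qed
  have "\<exists>\<rho>>0. seq_normal_on {f \<in> F. f z \<noteq> \<psi>1 z \<and> f z \<noteq> \<psi>2 z} (ball z \<rho>)"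
    by (rule pair[OF holo(1,2,3)]) (simp_all only: dist dist[symmetric] om not_False_eq_True)
  then obtain \<rho>1 where 1: "\<rho>1 > 0" "seq_normal_on {f \<in> F. f z \<noteq> \<psi>1 z \<and> f z \<noteq> \<psi>2 z} (ball z \<rho>1)"
    by blast
  have "\<exists>\<rho>>0. seq_normal_on {f \<in> F. f z \<noteq> \<psi>1 z \<and> f z \<noteq> \<psi>3 z} (ball z \<rho>)"
    by (rule pair[OF holo(1,3,2)]) (simp_all only: dist dist[symmetric] om not_False_eq_True)
  then obtain \<rho>2 where 2: "\<rho>2 > 0" "seq_normal_on {f \<in> F. f z \<noteq> \<psi>1 z \<and> f z \<noteq> \<psi>3 z} (ball z \<rho>2)"
    by blast
  have "\<exists>\<rho>>0. seq_normal_on {f \<in> F. f z \<noteq> \<psi>2 z \<and> f z \<noteq> \<psi>3 z} (ball z \<rho>)"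
    by (rule pair[OF holo(2,3,1)]) (simp_all only: dist dist[symmetric] om not_False_eq_True)
  then obtain \<rho>3 where 3: "\<rho>3 > 0" "seq_normal_on {f \<in> F. f z \<noteq> \<psi>2 z \<and> f z \<noteq> \<psi>3 z} (ball z \<rho>3)"
    by blast
  define \<rho> where "\<rho> = min \<rho>1 (min \<rho>2 \<rho>3)"
  have \<rho>: "ball z \<rho> \<subseteq> ball z \<rho>1" "ball z \<rho> \<subseteq> ball z \<rho>2" "ball z \<rho> \<subseteq> ball z \<rho>3"
    by (auto simp: \<rho>_def)
  have "F = {f \<in> F. f z \<noteq> \<psi>1 z \<and> f z \<noteq> \<psi>2 z} \<union> {f \<in> F. f z \<noteq> \<psi>1 z \<and> f z \<noteq> \<psi>3 z} \<union>
      {f \<in> F. f z \<noteq> \<psi>2 z \<and> f z \<noteq> \<psi>3 z}" (is "_ = ?F")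
    using centre by force
  moreover have "seq_normal_on ?F (ball z \<rho>)"
    by (intro seq_normal_on_Un seq_normal_on_subset[OF 1(2) \<rho>(1)] seq_normal_on_subset[OF 2(2) \<rho>(2)]
        seq_normal_on_subset[OF 3(2) \<rho>(3)])
  ultimately have "seq_normal_on F (ball z \<rho>)" by simp
  moreover have "\<rho> > 0" using 1(1) 2(1) 3(1) by (simp add: \<rho>_def)
  ultimately show ?thesis by blast
qed

section \<open>From local to global normality\<close>

text \<open>Stereographic images converge pointwise in Euclidean space, where limits are unique.
  Local limits of one sequence therefore agree on overlaps.\<close>

lemma sphere_limit_unique:
  assumes "sphere_limit s g U" "sphere_limit s h V" "w \<in> U" "w \<in> V"
  shows "g w = h w"
proof -
  have lim: "(\<lambda>n. stereo (s n w)) \<longlonglongrightarrow> stereo (f w)" if "sphere_limit s f W" "w \<in> W" for f W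
  proof (rule tendstoI)
    fix e :: real assume "e > 0"
    then have "\<forall>\<^sub>F n in sequentially. \<forall>z\<in>W. chordal (s n z) (f z) < e"
      using that(1) by (simp add: sphere_limit_def)
    then show "\<forall>\<^sub>F n in sequentially. dist (stereo (s n w)) (stereo (f w)) < e"
      by eventually_elim (use that(2) in \<open>simp add: chordal_eq_dist\<close>)
  qed
  have "stereo (g w) = stereo (h w)"
    by (rule LIMSEQ_unique[OF lim[OF assms(1,3)] lim[OF assms(2,4)]])
  then show ?thesis by (simp add: stereo_eq_iff)
qed

text \<open>A Lindelof cover reduces the problem to countably many open sets; a diagonal sequence
  converges on each of them, and the limits glue.\<close>

lemma normal_family_if_seq_normal_near:
  assumes \<Omega>: "open \<Omega>" "connected \<Omega>" "\<Omega> \<noteq> {}"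
    and loc: "\<And>z. z \<in> \<Omega> \<Longrightarrow> \<exists>\<rho>>0. seq_normal_on F (ball z \<rho>)"
  shows "normal_family_mero F \<Omega>"
  unfolding normal_family_mero_def
proof (intro allI impI)
  fix s :: "nat \<Rightarrow> complex \<Rightarrow> complex option"
  assume sF: "\<forall>n. s n \<in> F"
  define \<B> where "\<B> = {U. open U \<and> seq_normal_on F U}"
  obtain \<B>' where \<B>': "\<B>' \<subseteq> \<B>" "countable \<B>'" "\<Union>\<B>' = \<Union>\<B>"
    using Lindelof[of \<B>] by (auto simp: \<B>_def)
  have cover: "\<Omega> \<subseteq> \<Union>\<B>'"
  proof
    fix z assume "z \<in> \<Omega>"
    from loc[OF this] obtain \<rho> where "\<rho> > 0" "seq_normal_on F (ball z \<rho>)" by blast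
    then show "z \<in> \<Union>\<B>'" unfolding \<B>'(3) \<B>_def by (intro UnionI[of "ball z \<rho>"]) auto
  qed
  then have ne: "\<B>' \<noteq> {}" using \<Omega>(3) by blast
  define U where "U = from_nat_into \<B>'"
  have U: "open (U n)" "seq_normal_on F (U n)" for n
    using from_nat_into[OF ne, of n] \<B>'(1) by (auto simp: U_def \<B>_def)
  have UN: "\<Union>\<B>' = (\<Union>n. U n)"
    unfolding U_def by (simp add: range_from_nat_into[OF ne \<B>'(2)])
  define P where "P n k \<longleftrightarrow> (\<exists>g. sphere_limit (s \<circ> k) g (U n))" for n and k :: "nat \<Rightarrow> nat"
  have P: "\<exists>l. strict_mono (l :: nat \<Rightarrow> nat) \<and> P n (k \<circ> l)" for n k
  proof -
    have "\<forall>m. (s \<circ> k) m \<in> F" using sF by simp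
    from U(2)[of n, unfolded seq_normal_on_def, THEN spec, THEN mp, OF this]
    obtain l g where "strict_mono (l :: nat \<Rightarrow> nat)" "sphere_limit (s \<circ> k \<circ> l) g (U n)" by blast
    then show ?thesis unfolding P_def by (intro exI[of _ l]) (auto simp: o_assoc)
  qed
  interpret subseqs P by unfold_locales (rule P)
  define d where "d = s \<circ> diagseq"
  have "\<exists>g. sphere_limit d g (U n)" for n
  proof -
    \<comment> \<open>From index \<open>Suc n\<close> on, the diagonal sequence refines the one
      chosen for \<open>U n\<close>; the finite shift is removed below.\<close>
    have "P n (diagseq \<circ> ((+) (Suc n)))"
    proof (rule diagseq_holds)
      fix r t :: "nat \<Rightarrow> nat" and n
      assume "strict_mono r" "P n t"
      then show "P n (t \<circ> r)"
        unfolding P_def using sphere_limit_subseq by (metis o_assoc)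
    qed
    then obtain g where g: "sphere_limit (s \<circ> (diagseq \<circ> ((+) (Suc n)))) g (U n)" unfolding P_def by blast
    have "sphere_limit d g (U n)"
      unfolding sphere_limit_def
    proof (intro conjI allI impI)
      show "sphere_holo g (U n)" using g by (simp add: sphere_limit_def)
      fix e :: real assume "e > 0"
      then have "\<forall>\<^sub>F m in sequentially. \<forall>z\<in>U n. chordal (d (m + Suc n) z) (g z) < e"
        using g by (simp add: sphere_limit_def d_def add.commute)
      then show "\<forall>\<^sub>F m in sequentially. \<forall>z\<in>U n. chordal (d m z) (g z) < e"
        by (rule eventually_sequentially_seg[THEN iffD1])
    qed
    then show ?thesis by blast
  qed
  then obtain g where g: "\<And>n. sphere_limit d (g n) (U n)" by metis
  \<comment> \<open>\<open>LEAST\<close> just picks a member of the cover that contains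
    \<open>w\<close>; uniqueness of limits makes the value independent of the choice.\<close>
  define G where "G w = g (LEAST n. w \<in> U n) w" for w
  have G: "G w = g n w" if "w \<in> U n" for w n
    unfolding G_def by (rule sphere_limit_unique[OF g g LeastI[of "\<lambda>n. w \<in> U n", OF that] that])
  have "sphere_holo G \<Omega>"
  proof (rule sphere_holo_local)
    fix z assume "z \<in> \<Omega>"
    then obtain n where "z \<in> U n" using cover UN by blast
    then show "\<exists>V h. open V \<and> z \<in> V \<and> sphere_holo h V \<and> (\<forall>w\<in>V. G w = h w)"
      using U(1) g[of n] G by (intro exI[of _ "U n"] exI[of _ "g n"]) (simp add: sphere_limit_def)
  qed
  then have "mero_on G \<Omega> \<or> (\<forall>z\<in>\<Omega>. G z = None)"
    using \<Omega>(1,2) by (rule sphere_holo_imp_mero_on)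
  \<comment> \<open>Stated for every \<open>h\<close> that agrees with \<open>G\<close> on \<Omega>,
    because an infinite limit must be replaced by the function that is \<open>None\<close> outside
    \<Omega> as well.\<close>
  moreover have lim: "locally_uniform_chordal d h \<Omega>" if "\<And>z. z \<in> \<Omega> \<Longrightarrow> h z = G z" for h
    unfolding locally_uniform_chordal_def
  proof (intro allI impI)
    fix K :: "complex set" and e :: real
    assume K: "compact K \<and> K \<subseteq> \<Omega>" and e: "e > 0"
    have "K \<subseteq> (\<Union>n\<in>UNIV. U n)" using K cover UN by blast
    then obtain N where N: "finite N" "K \<subseteq> (\<Union>n\<in>N. U n)"
      using K U(1) by (metis compactE_image)
    have "\<forall>n\<in>N. \<forall>\<^sub>F m in sequentially. \<forall>z\<in>U n. chordal (d m z) (g n z) < e"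
      using g e by (simp add: sphere_limit_def)
    then have "\<forall>\<^sub>F m in sequentially. \<forall>n\<in>N. \<forall>z\<in>U n. chordal (d m z) (g n z) < e"
      by (rule eventually_ball_finite[OF N(1)])
    then show "\<forall>\<^sub>F m in sequentially. \<forall>z\<in>K. chordal (d m z) (h z) < e"
    proof eventually_elim
      case (elim m)
      show ?case
      proof
        fix z assume z: "z \<in> K"
        then obtain n where n: "n \<in> N" "z \<in> U n" using N(2) by blast
        have "h z = g n z" using that[of z] z K G[OF n(2)] by auto
        then show "chordal (d m z) (h z) < e" using elim n by simp
      qed
    qed
  qed
  ultimately have "\<exists>h. (mero_on h \<Omega> \<or> h = (\<lambda>z. None)) \<and> locally_uniform_chordal d h \<Omega>"
  proof (elim disjE)
    assume "mero_on G \<Omega>"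
    then show ?thesis using lim[of G] by blast
  next
    assume "\<forall>z\<in>\<Omega>. G z = None"
    then show ?thesis using lim[of "\<lambda>z. None"] by (intro exI[of _ "\<lambda>z. None"]) simp
  qed
  then show "\<exists>r h. strict_mono r \<and> (mero_on h \<Omega> \<or> h = (\<lambda>z. None)) \<and> locally_uniform_chordal (s \<circ> r) h \<Omega>"
    using subseq_diagseq unfolding d_def by blast
qed

section \<open>Families with finitely many restrictions to the domain\<close>

lemma locally_uniform_chordal_const:
  assumes "\<And>n z. z \<in> \<Omega> \<Longrightarrow> s n z = g z"
  shows "locally_uniform_chordal s g \<Omega>"
  unfolding locally_uniform_chordal_def
proof (intro allI impI always_eventually ballI)
  fix K :: "complex set" and e :: real and n z
  assume "compact K \<and> K \<subseteq> \<Omega>" "e > 0" "z \<in> K"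
  then have "s n z = g z" using assms by blast
  then show "chordal (s n z) (g z) < e" using \<open>e > 0\<close> by (simp add: chordal_eq_dist)
qed

text \<open>By the pigeonhole principle some \<open>g\<close> is matched by infinitely many terms.
  Agreement is asked on \<Omega> alone, as values elsewhere are arbitrary.\<close>

lemma normal_family_mero_finite:
  assumes "finite G" "\<forall>g\<in>G. mero_on g \<Omega>" "\<forall>f\<in>F. \<exists>g\<in>G. \<forall>z\<in>\<Omega>. f z = g z"
  shows "normal_family_mero F \<Omega>"
  unfolding normal_family_mero_def
proof (intro allI impI)
  fix s :: "nat \<Rightarrow> complex \<Rightarrow> complex option"
  assume "\<forall>n. s n \<in> F"
  then have "(\<Union>g\<in>G. {n. \<forall>z\<in>\<Omega>. s n z = g z}) = UNIV"
    using assms(3) by auto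
  then obtain g where g: "g \<in> G" "infinite {n. \<forall>z\<in>\<Omega>. s n z = g z}"
    using assms(1) by (metis (no_types, lifting) finite_UN infinite_UNIV_nat)
  from infinite_subseq[of "\<lambda>f. \<forall>z\<in>\<Omega>. f z = g z", OF g(2)]
  obtain k where k: "strict_mono (k :: nat \<Rightarrow> nat)" "\<forall>n. \<forall>z\<in>\<Omega>. (s \<circ> k) n z = g z" by blast
  show "\<exists>r h. strict_mono r \<and> (mero_on h \<Omega> \<or> h = (\<lambda>z. None)) \<and> locally_uniform_chordal (s \<circ> r) h \<Omega>"
    using k assms(2) g(1)
    by (intro exI[of _ k] exI[of _ g] conjI locally_uniform_chordal_const) auto
qed

section \<open>From one member of the family to all by the shared set\<close>

theorem theorem4:
  fixes \<Omega> :: "complex set"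
    and F :: "(complex \<Rightarrow> complex option) set"
    and \<psi>1 \<psi>2 \<psi>3 :: "complex \<Rightarrow> complex option"
  assumes "open \<Omega>" and "connected \<Omega>" and "\<Omega> \<noteq> {}"
    and "\<forall>f\<in>F. mero_on f \<Omega>"
    and "mero_on \<psi>1 \<Omega>" and "mero_on \<psi>2 \<Omega>" and "mero_on \<psi>3 \<Omega>"
    and "\<exists>z\<in>\<Omega>. \<psi>1 z \<noteq> \<psi>2 z" and "\<exists>z\<in>\<Omega>. \<psi>1 z \<noteq> \<psi>3 z" and "\<exists>z\<in>\<Omega>. \<psi>2 z \<noteq> \<psi>3 z"
    and "\<forall>f\<in>F. \<forall>g\<in>F. shares_set f g \<psi>1 \<psi>2 \<psi>3 \<Omega>"
    and "\<forall>f\<in>F. \<forall>z\<in>\<Omega>.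
           (\<psi>1 z = \<psi>2 z \<longrightarrow> f z \<noteq> \<psi>1 z) \<and>
           (\<psi>1 z = \<psi>3 z \<longrightarrow> f z \<noteq> \<psi>1 z) \<and>
           (\<psi>2 z = \<psi>3 z \<longrightarrow> f z \<noteq> \<psi>2 z)"
  shows "normal_family_mero F \<Omega>"
proof -
  have \<psi>: "sphere_holo \<psi>1 \<Omega>" "sphere_holo \<psi>2 \<Omega>" "sphere_holo \<psi>3 \<Omega>"
    using assms(1,5-7) mero_on_imp_sphere_holo by blast+
  have F: "\<forall>f\<in>F. sphere_holo f \<Omega>"
    using assms(1,4) mero_on_imp_sphere_holo by blast
  have shared: "g z \<in> {\<psi>1 z, \<psi>2 z, \<psi>3 z} \<longleftrightarrow> f z \<in> {\<psi>1 z, \<psi>2 z, \<psi>3 z}"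
    if "f \<in> F" "g \<in> F" "z \<in> \<Omega>" for f g z
  proof -
    have "shares_set f g \<psi>1 \<psi>2 \<psi>3 \<Omega>" using assms(11) that by blast
    then show ?thesis using that(3) unfolding shares_set_def set_eq_iff mem_Collect_eq by blast
  qed
  have \<Omega>at: "\<forall>\<^sub>F w in at z. w \<in> \<Omega>" if "z \<in> \<Omega>" for z
    using assms(1) that by (rule eventually_at_in_open')
  \<comment> \<open>The identity theorem isolates the coincidences of \<open>f\<close> with each of
    the three functions.\<close>
  have omit: "\<forall>\<^sub>F w in at z. f w \<notin> {\<psi>1 w, \<psi>2 w, \<psi>3 w}"
    if "f \<in> F" "z \<in> \<Omega>" "\<not> (\<exists>\<psi>\<in>{\<psi>1, \<psi>2, \<psi>3}. \<forall>z\<in>\<Omega>. f z = \<psi> z)" for f z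
  proof -
    have "\<forall>\<^sub>F w in at z. f w \<noteq> \<psi>1 w" "\<forall>\<^sub>F w in at z. f w \<noteq> \<psi>2 w" "\<forall>\<^sub>F w in at z. f w \<noteq> \<psi>3 w"
      using \<psi>[THEN sphere_holo_eq_or_isolated[OF bspec[OF F that(1)] _ assms(1,2)]] that(2,3) by blast+
    then show ?thesis by eventually_elim simp
  qed
  show ?thesis
  proof (cases "\<forall>f\<in>F. \<exists>\<psi>\<in>{\<psi>1, \<psi>2, \<psi>3}. \<forall>z\<in>\<Omega>. f z = \<psi> z")
    case True
    show ?thesis
      by (rule normal_family_mero_finite[OF _ _ True]) (use assms(5-7) in auto)
  next
    case False
    then obtain f where f: "f \<in> F" "\<not> (\<exists>\<psi>\<in>{\<psi>1, \<psi>2, \<psi>3}. \<forall>z\<in>\<Omega>. f z = \<psi> z)" by blast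
    show ?thesis
    proof (rule normal_family_if_seq_normal_near[OF assms(1-3)])
      fix z assume z: "z \<in> \<Omega>"
      show "\<exists>\<rho>>0. seq_normal_on F (ball z \<rho>)"
      proof (rule seq_normal_near[OF assms(1) z F \<psi>])
        show "\<forall>\<^sub>F w in at z. \<psi>1 w \<noteq> \<psi>2 w \<and> \<psi>1 w \<noteq> \<psi>3 w \<and> \<psi>2 w \<noteq> \<psi>3 w"
          using sphere_holo_eq_or_isolated[OF \<psi>(1,2) assms(1,2)] sphere_holo_eq_or_isolated[OF \<psi>(1,3) assms(1,2)]
            sphere_holo_eq_or_isolated[OF \<psi>(2,3) assms(1,2)] assms(8-10) z
          by (intro eventually_conj) blast+
        \<comment> \<open>Sharing transfers the omission from \<open>f\<close> to every
          \<open>g\<close> at the same points, so the punctured neighbourhood is common to the whole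
          family.\<close>
        show "\<forall>\<^sub>F w in at z. \<forall>g\<in>F. g w \<notin> {\<psi>1 w, \<psi>2 w, \<psi>3 w}"
          using omit[OF f(1) z f(2)] \<Omega>at[OF z]
        proof eventually_elim
          case (elim w)
          then show ?case using shared[OF f(1)] by blast
        qed
      qed (use assms(12) z in blast)
    qed
  qed
qed

end
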